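(* Let $k$ be a fixed positive integer. For each $n$, let $P_n$ be a positive integer and $p_n\in[0,1]$, and consider the binomial random intersection graph $G_b(n,P_n,p_n)$. Define the sequence $\alpha_n$ by $$p_n^2P_n=\frac{\ln n+(k-1)\ln\ln n+\alpha_n}{n}.$$ If $P_n=\Omega\big(n(\ln n)^5\big)$, then $$\lim_{n\to\infty}\mathbb{P}[G_b(n,P_n,p_n)\text{ is }k\text{-robust}]=\begin{cases}0,&\text{if }\lim_{n\to\infty}\alpha_n=-\infty,\\ 1,&\text{if }\lim_{n\to\infty}\alpha_n=\infty.\end{cases}$$
   Context: Binomial random intersection graph $G_b(n,P_n,p_n)$: node set $\{v_1,\dots,v_n\}$; there is a pool of $P_n$ distinct objects; independently for each node $v_i$, an object set $S_i$ is formed by including each object of the pool independently with probability $p_n$. Two distinct nodes $v_i,v_j$ are joined by an undirected edge iff $S_i\cap S_j\neq\emptyset$. A graph with node set $\mathcal{V}$ is $k$-robust if for every pair of non-empty disjoint subsets $A,B\subseteq\mathcal{V}$, at least one of the following holds: (a) some node of $A$ has at least $k$ neighbors in $\mathcal{V}\setminus A$; (b) some node of $B$ has at least $k$ neighbors in $\mathcal{V}\setminus B$. All parameters are sequences indexed by $n$, limits are as $n\to\infty$, $k$ does not depend on $n$, and $o,\omega,O,\Omega$ are standard Landau notation. *)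

theory Defs
  imports "HOL-Probability.Probability"
begin

text \<open>A simple undirected graph is a pair of a vertex set and a set of two-element edges.\<close>

type_synonym 'a graph = "'a set \<times> 'a set set"

definition neighbors_in :: "'a graph \<Rightarrow> 'a set \<Rightarrow> 'a \<Rightarrow> 'a set" where
  "neighbors_in G U v = {u \<in> U. {v, u} \<in> snd G}"

definition k_robust :: "nat \<Rightarrow> 'a graph \<Rightarrow> bool" where
  "k_robust k G \<longleftrightarrow>
    (\<forall>A B. A \<subseteq> fst G \<and> B \<subseteq> fst G \<and> A \<noteq> {} \<and> B \<noteq> {} \<and> A \<inter> B = {} \<longrightarrow>
      (\<exists>v\<in>A. k \<le> card (neighbors_in G (fst G - A) v)) \<or>
      (\<exists>v\<in>B. k \<le> card (neighbors_in G (fst G - B) v)))"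

definition intersection_graph :: "'a set \<Rightarrow> ('a \<Rightarrow> 'b set) \<Rightarrow> 'a graph" where
  "intersection_graph V S =
    (V, {{u, v} | u v. u \<in> V \<and> v \<in> V \<and> u \<noteq> v \<and> S u \<inter> S v \<noteq> {}})"

definition binomial_subset_pmf :: "'b set \<Rightarrow> real \<Rightarrow> 'b set pmf" where
  "binomial_subset_pmf W p =
    map_pmf (\<lambda>f. {w \<in> W. f w}) (Pi_pmf W False (\<lambda>_. bernoulli_pmf p))"

text \<open>The nodes are \<open>1, \<dots>, n\<close> and the pool of objects is \<open>{..<P}\<close>.\<close>

definition binomial_rig :: "nat \<Rightarrow> nat \<Rightarrow> real \<Rightarrow> nat graph pmf" where
  "binomial_rig n P p =
    map_pmf (intersection_graph {1..n})
      (Pi_pmf {1..n} {} (\<lambda>_. binomial_subset_pmf {..<P} p))"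

end

theory Submission
  imports Defs "HOL-Real_Asymp.Real_Asymp"
begin

text \<open>
  Robustness is monotone in the object sets, so by a coupling in \<open>p\<close> one may assume
  \<open>\<bar>\<alpha>\<^sub>n\<bar> \<le> ln ln n\<close>; then \<open>P = \<Omega>(n (ln n)\<^sup>5)\<close> makes \<open>n p ln n\<close> tend to 0.

  One-law: keep only the edges produced by objects held by exactly two nodes. Each object
  produces at most one such edge, every given edge with probability
  \<open>\<rho> = p\<^sup>2 (1 - p)\<^bsup>n-2\<^esup>\<close>, independently over the objects. A union bound over the sets \<open>A\<close> with
  \<open>m \<le> n/2\<close> nodes and over the possible neighbourhoods of size less than \<open>k\<close> outside \<open>A\<close> bounds the
  probability that some \<open>A\<close> of size \<open>m\<close> has no node with \<open>k\<close> neighbours outside \<open>A\<close> by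
  \<open>(C e\<^bsup>-\<alpha>\<^esup>)\<^bsup>m\<^esup>\<close>. Of two disjoint sets one has at most \<open>n/2\<close> nodes.

  Zero-law: a robust graph has minimum degree at least \<open>k\<close>. The second moment method is applied
  to the nodes \<open>v\<close> in one half of the node set all of whose objects are held by \<open>v\<close> alone, except for
  \<open>k - 1\<close> objects shared with exactly one node each, lying in the other half. Their expected number is at
  least a constant times \<open>e\<^bsup>-\<alpha>\<^esup>\<close>.
\<close>

section \<open>Couplings and the transposed model\<close>

text \<open>Induction over \<open>I\<close>, coupling the new coordinate independently of the
  others. The relation is required at every index, and \<open>R d d'\<close> covers the indices
  outside \<open>I\<close>.\<close>

lemma rel_pmf_Pi_pmf:
  assumes "finite I" "R d d'" "\<And>i. i \<in> I \<Longrightarrow> rel_pmf R (M i) (M' i)"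
  shows "rel_pmf (\<lambda>f g. \<forall>i. R (f i) (g i)) (Pi_pmf I d M) (Pi_pmf I d' M')"
  using assms(1,3)
proof (induction I rule: finite_induct)
  case empty
  then show ?case using assms(2) by simp
next
  case (insert x I)
  show ?case
    unfolding Pi_pmf_insert'[OF insert.hyps]
    using insert by (intro rel_pmf_bindI[of R] rel_pmf_bindI[of "\<lambda>f g. \<forall>i. R (f i) (g i)"]) auto
qed

text \<open>Thinning: a success of the \<open>q\<close>-variable is kept with probability
  \<open>p / q\<close>, which leaves a \<open>p\<close>-variable that implies the original one. The
  quotient forces \<open>q = 0\<close> to be treated apart.\<close>

lemma rel_pmf_bernoulli:
  assumes "0 \<le> p" "p \<le> q" "q \<le> 1"
  shows "rel_pmf (\<longrightarrow>) (bernoulli_pmf p) (bernoulli_pmf q)"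
proof (cases "q = 0")
  case True
  then show ?thesis using assms by (auto intro: rel_pmf_reflI)
next
  case False
  define f where "f b = (if b then bernoulli_pmf (p / q) else return_pmf False)" for b
  have pq: "0 \<le> p / q" "p / q \<le> 1" using False assms by (auto simp: divide_simps)
  have eq: "bernoulli_pmf p = bind_pmf (bernoulli_pmf q) f"
  proof (rule pmf_eqI)
    fix b
    show "pmf (bernoulli_pmf p) b = pmf (bind_pmf (bernoulli_pmf q) f) b"
      using False assms pq by (cases b) (auto simp: pmf_bind f_def field_simps)
  qed
  have "rel_pmf (\<longrightarrow>) (bind_pmf (bernoulli_pmf q) f) (bind_pmf (bernoulli_pmf q) return_pmf)"
    by (rule rel_pmf_bindI[of "(=)"]) (auto simp: rel_pmf_return_pmf2 f_def pmf.rel_eq)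
  then show ?thesis by (simp add: eq bind_return_pmf')
qed

lemma rel_pmf_binomial_subset:
  assumes "finite W" "0 \<le> p" "p \<le> q" "q \<le> 1"
  shows "rel_pmf (\<subseteq>) (binomial_subset_pmf W p) (binomial_subset_pmf W q)"
  unfolding binomial_subset_pmf_def pmf.rel_map
  by (rule pmf.rel_mono_strong[OF rel_pmf_Pi_pmf[OF _ _ rel_pmf_bernoulli]]) (use assms in auto)

lemma prob_Pi_pmf_Ball:
  assumes "finite W"
  shows "measure_pmf.prob (Pi_pmf W d M) {X. \<forall>w\<in>W. X w \<in> B w} =
    (\<Prod>w\<in>W. measure_pmf.prob (M w) (B w))"
  using measure_Pi_pmf_Pi[OF assms, of d M B] by (simp add: Pi_def Ball_def)

lemma pmf_binomial_subset:
  assumes "finite V" "0 \<le> p" "p \<le> 1"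
  shows "pmf (binomial_subset_pmf V p) T =
    (if T \<subseteq> V then \<Prod>v\<in>V. if v \<in> T then p else 1 - p else 0)"
proof (cases "T \<subseteq> V")
  case True
  then have "(\<lambda>f. {w \<in> V. f w}) -` {T} = {f. \<forall>v\<in>V. f v \<in> {v \<in> T}}" by auto
  then have "pmf (binomial_subset_pmf V p) T =
      measure_pmf.prob (Pi_pmf V False (\<lambda>_. bernoulli_pmf p)) {f. \<forall>v\<in>V. f v \<in> {v \<in> T}}"
    by (simp add: binomial_subset_pmf_def pmf_map)
  also have "\<dots> = (\<Prod>v\<in>V. measure_pmf.prob (bernoulli_pmf p) {v \<in> T})"
    by (rule prob_Pi_pmf_Ball[OF assms(1)])
  also have "\<dots> = (\<Prod>v\<in>V. if v \<in> T then p else 1 - p)"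
    using assms by (intro prod.cong refl) (simp add: measure_pmf_single)
  finally show ?thesis using True by simp
next
  case False
  then have "(\<lambda>f. {w \<in> V. f w}) -` {T} = {}" by auto
  then show ?thesis using False
    by (simp add: binomial_subset_pmf_def pmf_map)
qed

lemma pmf_binomial_subset_card:
  assumes "finite V" "0 \<le> p" "p \<le> 1" "T \<subseteq> V"
  shows "pmf (binomial_subset_pmf V p) T = p ^ card T * (1 - p) ^ (card V - card T)"
proof -
  have "(\<Prod>v\<in>V. if v \<in> T then p else 1 - p) = (\<Prod>v\<in>T. p) * (\<Prod>v\<in>V - T. 1 - p)"
    using assms by (subst prod.If_cases) (auto intro!: arg_cong2[of _ _ _ _ "(*)"] simp: Int_absorb1 Diff_eq)
  then show ?thesis using assms finite_subset[OF assms(4,1)]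
    by (simp add: pmf_binomial_subset card_Diff_subset)
qed

text \<open>Both sides read one matrix of independent Bernoulli entries over \<open>V\<close> and
  \<open>W\<close>, by rows or by columns. At a given \<open>S\<close> the two masses are the same
  double product up to \<open>prod.swap\<close>.\<close>

lemma Pi_pmf_binomial_subset_transpose:
  assumes "finite V" "finite W" "0 \<le> p" "p \<le> 1"
  shows "Pi_pmf V {} (\<lambda>_. binomial_subset_pmf W p) =
    map_pmf (\<lambda>X v. {w \<in> W. v \<in> X w}) (Pi_pmf W {} (\<lambda>_. binomial_subset_pmf V p))"
proof (rule pmf_eqI)
  fix S :: "'a \<Rightarrow> 'b set"
  let ?M = "Pi_pmf W {} (\<lambda>_. binomial_subset_pmf V p)"
  let ?f = "\<lambda>X v. {w \<in> W. v \<in> X w}"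
  show "pmf (Pi_pmf V {} (\<lambda>_. binomial_subset_pmf W p)) S = pmf (map_pmf ?f ?M) S"
  proof (cases "\<forall>v. S v \<subseteq> W")
    case False
    then obtain v where v: "\<not> S v \<subseteq> W" by auto
    then have "?f -` {S} = {}" by auto
    moreover have "pmf (Pi_pmf V {} (\<lambda>_. binomial_subset_pmf W p)) S = 0"
      using v assms by (auto simp: pmf_Pi pmf_binomial_subset)
    ultimately show ?thesis by (simp add: pmf_map)
  next
    case True
    \<comment> \<open>The map forgets \<open>X\<close> outside \<open>W\<close>, so the fibre over
      \<open>S\<close> is a product event with one prescribed set per object.\<close>
    then have eq: "?f -` {S} = {X. \<forall>w\<in>W. X w \<in> {{v. w \<in> S v}}}"
      by (auto simp: fun_eq_iff) blast+
    have "pmf (map_pmf ?f ?M) S = (\<Prod>w\<in>W. pmf (binomial_subset_pmf V p) {v. w \<in> S v})"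
      unfolding pmf_map eq unfolding prob_Pi_pmf_Ball[OF assms(2)] by (simp add: measure_pmf_single)
    also have "\<dots> = pmf (Pi_pmf V {} (\<lambda>_. binomial_subset_pmf W p)) S"
    proof (cases "\<forall>v. v \<notin> V \<longrightarrow> S v = {}")
      case outside: True
      then have "(\<Prod>w\<in>W. pmf (binomial_subset_pmf V p) {v. w \<in> S v}) =
        (\<Prod>w\<in>W. \<Prod>v\<in>V. if w \<in> S v then p else 1 - p)"
        using assms by (intro prod.cong refl) (auto simp: pmf_binomial_subset)
      also have "\<dots> = (\<Prod>v\<in>V. \<Prod>w\<in>W. if w \<in> S v then p else 1 - p)"
        by (rule prod.swap)
      finally show ?thesis
        using assms True outside by (simp add: pmf_Pi pmf_binomial_subset)
    next
      \<comment> \<open>If some node outside \<open>V\<close> holds an object, both masses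
        vanish.\<close>
      case False
      then obtain v w where "v \<notin> V" "w \<in> S v" by auto
      then have "\<not> {v. w \<in> S v} \<subseteq> V" "w \<in> W" using True by auto
      then have "(\<Prod>w\<in>W. pmf (binomial_subset_pmf V p) {v. w \<in> S v}) = 0"
        using assms by (intro prod_zero) (auto simp: pmf_binomial_subset intro!: bexI[of _ w])
      then show ?thesis using assms False by (subst pmf_Pi_outside) auto
    qed
    finally show ?thesis by simp
  qed
qed

text \<open>The transposed model: \<open>X w\<close> is the set of nodes that hold the object \<open>w\<close>.  These sets are
  independent over the objects.\<close>

definition membership_pmf :: "'a set \<Rightarrow> 'b set \<Rightarrow> real \<Rightarrow> ('b \<Rightarrow> 'a set) pmf" where
  "membership_pmf V W p = Pi_pmf W {} (\<lambda>_. binomial_subset_pmf V p)"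

definition membership_graph :: "'a set \<Rightarrow> 'b set \<Rightarrow> ('b \<Rightarrow> 'a set) \<Rightarrow> 'a graph" where
  "membership_graph V W X = intersection_graph V (\<lambda>v. {w \<in> W. v \<in> X w})"

lemma binomial_rig_membership:
  assumes "0 \<le> p" "p \<le> 1"
  shows "binomial_rig n P p =
    map_pmf (membership_graph {1..n} {..<P}) (membership_pmf {1..n} {..<P} p)"
  unfolding binomial_rig_def membership_pmf_def membership_graph_def
  by (subst Pi_pmf_binomial_subset_transpose) (use assms in \<open>auto simp: pmf.map_comp o_def\<close>)

section \<open>Robustness and minimum degree of intersection graphs\<close>

lemma neighbors_in_intersection_graph:
  "neighbors_in (intersection_graph V S) U v =
    {u \<in> U. u \<in> V \<and> v \<in> V \<and> u \<noteq> v \<and> S u \<inter> S v \<noteq> {}}"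
  unfolding neighbors_in_def intersection_graph_def by (auto simp: doubleton_eq_iff)

lemma fst_intersection_graph [simp]: "fst (intersection_graph V S) = V"
  by (simp add: intersection_graph_def)

lemma k_robust_intersection_graph_mono:
  assumes "finite V" "k_robust k (intersection_graph V S)" "\<And>v. S v \<subseteq> S' v"
  shows "k_robust k (intersection_graph V S')"
proof -
  have "card (neighbors_in (intersection_graph V S) (V - A) v) \<le>
      card (neighbors_in (intersection_graph V S') (V - A) v)" for A v
    using assms(1,3) unfolding neighbors_in_intersection_graph
    by (intro card_mono) (auto, blast)
  then show ?thesis using assms(2) unfolding k_robust_def fst_intersection_graph
    by (meson le_trans)
qed

text \<open>In the coupling every object set for \<open>p\<close> lies inside the one for
  \<open>q\<close>, and robustness survives enlarging the object sets.\<close>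

lemma prob_k_robust_mono:
  assumes "0 \<le> p" "p \<le> q" "q \<le> 1"
  shows "measure_pmf.prob (binomial_rig n P p) {G. k_robust k G} \<le>
    measure_pmf.prob (binomial_rig n P q) {G. k_robust k G}"
proof -
  let ?M = "\<lambda>p. Pi_pmf {1..n} {} (\<lambda>_. binomial_subset_pmf {..<P} p)"
  let ?g = "intersection_graph {1..n}"
  have "rel_pmf (\<lambda>f g. \<forall>i. f i \<subseteq> g i) (?M p) (?M q)"
    using assms by (intro rel_pmf_Pi_pmf rel_pmf_binomial_subset) auto
  then have "measure_pmf.prob (?M p) (?g -` {G. k_robust k G}) \<le>
    measure_pmf.prob (?M q) {S'. \<exists>S\<in>?g -` {G. k_robust k G}. \<forall>i. S i \<subseteq> S' i}"
    by (rule rel_pmf_measureD)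
  also have "\<dots> \<le> measure_pmf.prob (?M q) (?g -` {G. k_robust k G})"
    by (rule measure_pmf.finite_measure_mono)
      (auto intro: k_robust_intersection_graph_mono[rotated])
  finally show ?thesis by (simp add: binomial_rig_def)
qed

text \<open>Of two disjoint sets the smaller has at most half of the nodes, so such sets suffice. An
  object held by exactly \<open>v\<close> and \<open>u\<close> is only one possible reason for the
  edge, but these events have simple probabilities.\<close>

lemma k_robust_membership_graphI:
  assumes "finite V"
    and reach: "\<And>A. A \<subseteq> V \<Longrightarrow> A \<noteq> {} \<Longrightarrow> 2 * card A \<le> card V \<Longrightarrow>
      \<exists>v\<in>A. k \<le> card {u \<in> V - A. \<exists>w\<in>W. X w = {v, u}}"
  shows "k_robust k (membership_graph V W X)"
proof -
  have *: "\<exists>v\<in>A. k \<le> card (neighbors_in (membership_graph V W X) (V - A) v)"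
    if A: "A \<subseteq> V" "A \<noteq> {}" "2 * card A \<le> card V" for A
  proof -
    obtain v where v: "v \<in> A" "k \<le> card {u \<in> V - A. \<exists>w\<in>W. X w = {v, u}}"
      using reach[OF A] by blast
    have "card {u \<in> V - A. \<exists>w\<in>W. X w = {v, u}} \<le>
        card (neighbors_in (membership_graph V W X) (V - A) v)"
      using assms(1) A(1) v(1) unfolding membership_graph_def neighbors_in_intersection_graph
      by (intro card_mono) auto
    then show ?thesis using v by (meson le_trans)
  qed
  show ?thesis
    unfolding k_robust_def
  proof (intro allI impI)
    fix A B
    assume "A \<subseteq> fst (membership_graph V W X) \<and> B \<subseteq> fst (membership_graph V W X) \<and>
      A \<noteq> {} \<and> B \<noteq> {} \<and> A \<inter> B = {}"
    then have AB: "A \<subseteq> V" "B \<subseteq> V" "A \<noteq> {}" "B \<noteq> {}" "A \<inter> B = {}"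
      by (auto simp: membership_graph_def)
    then have "card A + card B \<le> card V"
      using assms(1) card_mono[of V "A \<union> B"] finite_subset[of _ V]
      by (simp add: card_Un_disjoint)
    then have "2 * card A \<le> card V \<or> 2 * card B \<le> card V" by linarith
    then show "(\<exists>v\<in>A. k \<le> card (neighbors_in (membership_graph V W X) (fst (membership_graph V W X) - A) v)) \<or>
      (\<exists>v\<in>B. k \<le> card (neighbors_in (membership_graph V W X) (fst (membership_graph V W X) - B) v))"
      using *[of A] *[of B] AB by (auto simp: membership_graph_def)
  qed
qed

text \<open>Robustness is tested on \<open>{v}\<close> and its complement. If the second alternative
  holds, some \<open>u\<close> has at least \<open>k\<close> neighbours inside \<open>{v}\<close>:
  either \<open>k = 0\<close>, or \<open>k \<le> 1\<close> and \<open>u\<close> itself is a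
  neighbour of \<open>v\<close>.\<close>

lemma k_robust_imp_degree_ge:
  assumes "finite V" "k_robust k (intersection_graph V S)" "v \<in> V" "card V \<ge> 2"
  shows "k \<le> card (neighbors_in (intersection_graph V S) (V - {v}) v)"
proof -
  let ?G = "intersection_graph V S"
  have ne: "V - {v} \<noteq> {}"
    using assms by (metis One_nat_def card.empty card_Suc_Diff1 not_less_eq_eq numeral_2_eq_2 order_refl)
  have "k \<le> card (neighbors_in ?G (V - {v}) v) \<or>
      (\<exists>u\<in>V - {v}. k \<le> card (neighbors_in ?G (V - (V - {v})) u))"
    using assms(2)[unfolded k_robust_def, rule_format, of "{v}" "V - {v}"] assms(3) ne by auto
  then show ?thesis
  proof
    assume "\<exists>u\<in>V - {v}. k \<le> card (neighbors_in ?G (V - (V - {v})) u)"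
    then obtain u where u: "u \<in> V - {v}" "k \<le> card (neighbors_in ?G (V - (V - {v})) u)" by blast
    show ?thesis
    proof (cases "S u \<inter> S v = {}")
      case True
      then have "neighbors_in ?G (V - (V - {v})) u = {}"
        by (auto simp: neighbors_in_intersection_graph)
      then show ?thesis using u by simp
    next
      case False
      have "neighbors_in ?G (V - (V - {v})) u \<subseteq> {v}"
        by (auto simp: neighbors_in_intersection_graph)
      then have "k \<le> 1" using u(2) card_mono[of "{v}"] by (metis One_nat_def card.empty card_insert_disjoint finite.intros empty_iff le_trans)
      moreover have "{u} \<subseteq> neighbors_in ?G (V - {v}) v"
        using False u assms(3) by (auto simp: neighbors_in_intersection_graph)
      then have "1 \<le> card (neighbors_in ?G (V - {v}) v)"
        using card_mono[of "neighbors_in ?G (V - {v}) v" "{u}"] assms(1)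
        by (simp add: neighbors_in_def)
      ultimately show ?thesis by linarith
    qed
  qed
qed

section \<open>The one-law\<close>

lemma prod_if_mem_subset:
  fixes b a :: "'b :: comm_monoid_mult"
  assumes "finite W" "I \<subseteq> W"
  shows "(\<Prod>w\<in>W. if w \<in> I then b else a) = b ^ card I * a ^ (card W - card I)"
proof -
  have "W \<inter> {w. w \<in> I} = I" "W \<inter> - {w. w \<in> I} = W - I" using assms by auto
  then show ?thesis
    using assms finite_subset[OF assms(2,1)] by (simp add: prod.If_cases card_Diff_subset)
qed

lemma prob_binomial_subset_pairs:
  assumes "finite V" "0 \<le> p" "p \<le> 1" "D \<subseteq> {e. e \<subseteq> V \<and> card e = 2}"
  shows "measure_pmf.prob (binomial_subset_pmf V p) D =
    real (card D) * (p\<^sup>2 * (1 - p) ^ (card V - 2))"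
proof -
  have "finite D"
    using assms by (intro finite_subset[of D "Pow V"]) auto
  then have "measure_pmf.prob (binomial_subset_pmf V p) D = (\<Sum>e\<in>D. pmf (binomial_subset_pmf V p) e)"
    by (rule measure_measure_pmf_finite)
  also have "\<dots> = (\<Sum>e\<in>D. p\<^sup>2 * (1 - p) ^ (card V - 2))"
    using assms by (intro sum.cong refl) (auto simp: pmf_binomial_subset_card subset_iff)
  finally show ?thesis by simp
qed

text \<open>An object whose node set is a pair accounts for one edge only, so distinct pairs of \<open>H\<close> are hit
  by distinct objects; the bound is the union bound over the injections of \<open>H\<close> into \<open>W\<close>.\<close>

lemma prob_hit_avoid_pairs_le:
  fixes V :: "'a set" and W :: "'b set"
  assumes "finite V" "finite W" "0 \<le> p" "p \<le> 1"
    and H: "H \<subseteq> {e. e \<subseteq> V \<and> card e = 2}" and D: "D \<subseteq> {e. e \<subseteq> V \<and> card e = 2}"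
  defines "\<rho> \<equiv> p\<^sup>2 * (1 - p) ^ (card V - 2)"
  shows "measure_pmf.prob (membership_pmf V W p)
      {X. (\<forall>w\<in>W. X w \<notin> D) \<and> (\<forall>h\<in>H. \<exists>w\<in>W. X w = h)} \<le>
    (real (card W) * \<rho>) ^ card H * (1 - real (card D) * \<rho>) ^ (card W - card H)"
proof -
  let ?M = "membership_pmf V W p"
  let ?B = "binomial_subset_pmf V p"
  define Gs where "Gs = {g \<in> H \<rightarrow>\<^sub>E W. inj_on g H}"
  \<comment> \<open>Given the injection \<open>g\<close>, the object \<open>g h\<close> must have
    exactly \<open>h\<close> as its node set, recovered by \<open>inv_into\<close>; every other
    object only has to avoid \<open>D\<close>.\<close>
  define C where "C g w = (if w \<in> g ` H then {inv_into H g w} else - D)" for g :: "'a set \<Rightarrow> 'b" and w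
  define c where "c = 1 - real (card D) * \<rho>"
  have "finite H" using H assms(1) by (intro finite_subset[of H "Pow V"]) auto
  then have finP: "finite (H \<rightarrow>\<^sub>E W)" using assms(2) by (intro finite_PiE)
  have "Gs \<subseteq> H \<rightarrow>\<^sub>E W" by (auto simp: Gs_def)
  then have finGs: "finite Gs" "card Gs \<le> card W ^ card H"
    using finP card_mono[OF finP, of Gs] finite_subset[of Gs] \<open>finite H\<close> by (simp_all add: card_PiE)
  have "\<rho> \<ge> 0" using assms by (simp add: \<rho>_def)
  have c: "measure_pmf.prob ?B (- D) = c"
    using prob_binomial_subset_pairs[OF assms(1,3,4) D] measure_pmf.prob_compl[of D ?B]
    by (simp add: c_def \<rho>_def Compl_eq_Diff_UNIV)
  then have "c \<ge> 0" using measure_nonneg by metis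
  have "{X. (\<forall>w\<in>W. X w \<notin> D) \<and> (\<forall>h\<in>H. \<exists>w\<in>W. X w = h)} \<subseteq> (\<Union>g\<in>Gs. {X. \<forall>w\<in>W. X w \<in> C g w})"
  proof
    fix X assume "X \<in> {X. (\<forall>w\<in>W. X w \<notin> D) \<and> (\<forall>h\<in>H. \<exists>w\<in>W. X w = h)}"
    then have X: "\<And>w. w \<in> W \<Longrightarrow> X w \<notin> D" "\<forall>h\<in>H. \<exists>w\<in>W. X w = h" by auto
    then obtain g0 where g0: "\<And>h. h \<in> H \<Longrightarrow> g0 h \<in> W \<and> X (g0 h) = h" by metis
    define g where "g = restrict g0 H"
    have g: "\<And>h. h \<in> H \<Longrightarrow> g h \<in> W \<and> X (g h) = h" using g0 by (simp add: g_def)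
    then have inj: "inj_on g H" by (metis inj_onI)
    have "g \<in> Gs" using inj g0 by (auto simp: Gs_def g_def)
    moreover have "X w \<in> C g w" if "w \<in> W" for w
      using X(1)[OF that] g inj by (auto simp: C_def)
    ultimately show "X \<in> (\<Union>g\<in>Gs. {X. \<forall>w\<in>W. X w \<in> C g w})" by auto
  qed
  then have "measure_pmf.prob ?M {X. (\<forall>w\<in>W. X w \<notin> D) \<and> (\<forall>h\<in>H. \<exists>w\<in>W. X w = h)} \<le>
      measure_pmf.prob ?M (\<Union>g\<in>Gs. {X. \<forall>w\<in>W. X w \<in> C g w})"
    by (intro measure_pmf.finite_measure_mono) auto
  also have "\<dots> \<le> (\<Sum>g\<in>Gs. measure_pmf.prob ?M {X. \<forall>w\<in>W. X w \<in> C g w})"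
    using finGs(1) by (intro measure_pmf.finite_measure_subadditive_finite) auto
  also have "\<dots> = (\<Sum>g\<in>Gs. \<rho> ^ card H * c ^ (card W - card H))"
  proof (rule sum.cong[OF refl])
    fix g assume "g \<in> Gs"
    then have g: "g ` H \<subseteq> W" "inj_on g H" by (auto simp: Gs_def)
    have "measure_pmf.prob ?M {X. \<forall>w\<in>W. X w \<in> C g w} = (\<Prod>w\<in>W. measure_pmf.prob ?B (C g w))"
      unfolding membership_pmf_def by (rule prob_Pi_pmf_Ball[OF assms(2)])
    also have "\<dots> = (\<Prod>w\<in>W. if w \<in> g ` H then \<rho> else c)"
    proof (rule prod.cong[OF refl])
      fix w
      show "measure_pmf.prob ?B (C g w) = (if w \<in> g ` H then \<rho> else c)"
      proof (cases "w \<in> g ` H")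
        case True
        then have "{inv_into H g w} \<subseteq> {e. e \<subseteq> V \<and> card e = 2}" using H inv_into_into[OF True] by auto
        from prob_binomial_subset_pairs[OF assms(1,3,4) this] show ?thesis
          using True by (simp add: C_def \<rho>_def)
      next
        case False
        then show ?thesis by (simp add: C_def c)
      qed
    qed
    also have "\<dots> = \<rho> ^ card H * c ^ (card W - card H)"
      unfolding prod_if_mem_subset[OF assms(2) g(1)] by (simp add: card_image[OF g(2)])
    finally show "measure_pmf.prob ?M {X. \<forall>w\<in>W. X w \<in> C g w} = \<rho> ^ card H * c ^ (card W - card H)" .
  qed
  also have "\<dots> = real (card Gs) * (\<rho> ^ card H * c ^ (card W - card H))" by simp
  also have "\<dots> \<le> real (card W ^ card H) * (\<rho> ^ card H * c ^ (card W - card H))"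
    using finGs(2) \<open>\<rho> \<ge> 0\<close> \<open>c \<ge> 0\<close> by (intro mult_right_mono) (auto simp del: of_nat_power)
  also have "\<dots> = (real (card W) * \<rho>) ^ card H * c ^ (card W - card H)"
    by (simp add: power_mult_distrib)
  finally show ?thesis unfolding c_def .
qed

text \<open>There are at most \<open>card U ^ j\<close> subsets of size \<open>j\<close>, so each of
  the \<open>k\<close> sizes contributes at most \<open>z ^ j\<close>, hence at most
  \<open>z ^ (k - 1)\<close> because \<open>1 \<le> z\<close>.\<close>

lemma sum_power_card_small_subsets_le:
  fixes y z :: real
  assumes "finite U" "0 \<le> y" "1 \<le> z" "real (card U) * y \<le> z"
  shows "(\<Sum>B | B \<subseteq> U \<and> card B < k. y ^ card B) \<le> real k * z ^ (k - 1)"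
proof -
  have "{B. B \<subseteq> U \<and> card B < k} = (\<Union>j\<in>{..<k}. {B. B \<subseteq> U \<and> card B = j})" by auto
  then have "(\<Sum>B | B \<subseteq> U \<and> card B < k. y ^ card B) =
      (\<Sum>j<k. \<Sum>B | B \<subseteq> U \<and> card B = j. y ^ card B)"
    using assms(1) by (simp, subst sum.UNION_disjoint) auto
  also have "\<dots> = (\<Sum>j<k. real (card U choose j) * y ^ j)"
    using n_subsets[OF assms(1)] by (intro sum.cong refl) simp
  also have "\<dots> \<le> (\<Sum>j<k. z ^ (k - 1))"
  proof (rule sum_mono)
    fix j assume "j \<in> {..<k}"
    have "card U choose j \<le> card U ^ j"
      by (cases "j \<le> card U") (auto intro: binomial_le_pow simp: binomial_eq_0)
    then have "real (card U choose j) * y ^ j \<le> real (card U) ^ j * y ^ j"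
      using assms(2) by (intro mult_right_mono) (auto simp flip: of_nat_power)
    also have "\<dots> = (real (card U) * y) ^ j" by (simp add: power_mult_distrib)
    also have "\<dots> \<le> z ^ j" using assms by (intro power_mono) auto
    also have "\<dots> \<le> z ^ (k - 1)" using assms \<open>j \<in> {..<k}\<close> by (intro power_increasing) auto
    finally show "real (card U choose j) * y ^ j \<le> z ^ (k - 1)" .
  qed
  finally show ?thesis by simp
qed

text \<open>The union bound runs over the exact neighbourhoods \<open>N v\<close> of the nodes of
  \<open>A\<close>: pairs in \<open>H N\<close> are hit and all other pairs leaving \<open>A\<close>
  are missed. The bound for a fixed \<open>N\<close> is a product over \<open>A\<close>, so the sum
  over all \<open>N\<close> factors into a power with exponent \<open>card A\<close>.\<close>

lemma prob_unreachable_set_le: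
  fixes V :: "'a set" and W :: "'b set"
  assumes "finite V" "finite W" "0 \<le> p" "p \<le> 1" "A \<subseteq> V"
  defines "\<rho> \<equiv> p\<^sup>2 * (1 - p) ^ (card V - 2)"
  assumes "real (card W) * \<rho> \<le> 1"
    and z: "1 \<le> z" "real (card V) * (real (card W) * \<rho> * exp 2) \<le> z"
  shows "measure_pmf.prob (membership_pmf V W p)
      {X. \<forall>v\<in>A. card {u \<in> V - A. \<exists>w\<in>W. X w = {v, u}} < k} \<le>
    (real k * z ^ (k - 1) * exp (- (real (card V) - real (card A)) * (real (card W) * \<rho>))) ^ card A"
proof -
  let ?M = "membership_pmf V W p"
  let ?e = "\<lambda>(v, u). {v, u}"
  define n m r where "n = card V" and "m = card A" and "r = real (card W) * \<rho>"
  define Ns where "Ns = A \<rightarrow>\<^sub>E {B. B \<subseteq> V - A \<and> card B < k}"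
  define H where "H N = ?e ` Sigma A N" for N :: "'a \<Rightarrow> 'a set"
  define D where "D N = ?e ` Sigma A (\<lambda>v. V - A - N v)" for N :: "'a \<Rightarrow> 'a set"
  define E where "E N = {X. (\<forall>w\<in>W. X w \<notin> D N) \<and> (\<forall>h\<in>H N. \<exists>w\<in>W. X w = h)}" for N :: "'a \<Rightarrow> 'a set"
  have finA: "finite A" using assms(1,5) finite_subset by blast
  have finS: "finite {B. B \<subseteq> V - A \<and> card B < k}" using assms(1) by simp
  have mn: "m \<le> n" unfolding m_def n_def using assms(1,5) by (intro card_mono) auto
  have rho: "\<rho> \<ge> 0" using assms by (simp add: \<rho>_def)
  then have r: "0 \<le> r" "r \<le> 1" using assms by (auto simp: r_def)
  \<comment> \<open>One endpoint lies in \<open>A\<close> and the other outside, so a pair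
    determines which is which and no edge is counted twice.\<close>
  have inj: "inj_on ?e (A \<times> (V - A))" by (auto simp: inj_on_def doubleton_eq_iff)
  have finNs: "finite Ns" unfolding Ns_def using finA finS by (intro finite_PiE)
  have "{X. \<forall>v\<in>A. card {u \<in> V - A. \<exists>w\<in>W. X w = {v, u}} < k} \<subseteq> (\<Union>N\<in>Ns. E N)"
  proof
    fix X assume X: "X \<in> {X. \<forall>v\<in>A. card {u \<in> V - A. \<exists>w\<in>W. X w = {v, u}} < k}"
    define N where "N = restrict (\<lambda>v. {u \<in> V - A. \<exists>w\<in>W. X w = {v, u}}) A"
    have "N \<in> Ns" using X by (auto simp: Ns_def N_def)
    moreover have "X \<in> E N" by (auto simp: E_def D_def H_def N_def)
    ultimately show "X \<in> (\<Union>N\<in>Ns. E N)" by blast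
  qed
  then have "measure_pmf.prob ?M {X. \<forall>v\<in>A. card {u \<in> V - A. \<exists>w\<in>W. X w = {v, u}} < k} \<le>
      measure_pmf.prob ?M (\<Union>N\<in>Ns. E N)"
    by (intro measure_pmf.finite_measure_mono) auto
  also have "\<dots> \<le> (\<Sum>N\<in>Ns. measure_pmf.prob ?M (E N))"
    using finNs by (intro measure_pmf.finite_measure_subadditive_finite) auto
  also have "\<dots> \<le> (\<Sum>N\<in>Ns. \<Prod>v\<in>A. (r * exp 2) ^ card (N v) * exp (- (real n - real m) * r))"
  proof (rule sum_mono)
    fix N assume "N \<in> Ns"
    then have N: "N v \<subseteq> V - A" if "v \<in> A" for v using that by (auto simp: Ns_def)
    then have finN: "finite (N v)" if "v \<in> A" for v
      using that assms(1) finite_subset by (metis finite_Diff)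
    define h where "h = (\<Sum>v\<in>A. card (N v))"
    have "inj_on ?e (Sigma A N)" "inj_on ?e (Sigma A (\<lambda>v. V - A - N v))"
      using N by (auto intro!: inj_on_subset[OF inj])
    then have cards: "card (H N) = h" "card (D N) = (\<Sum>v\<in>A. card (V - A - N v))"
      using finA finN assms(1) by (auto simp: H_def D_def card_image h_def)
    have "real (card (V - A - N v)) = (real n - real m) - real (card (N v))" if "v \<in> A" for v
    proof -
      have "card (N v) \<le> card (V - A)" using N[OF that] assms(1) by (intro card_mono) auto
      moreover have "card (V - A - N v) = card (V - A) - card (N v)"
        using N[OF that] finN[OF that] by (intro card_Diff_subset) auto
      moreover have "card (V - A) = n - m"
        using finA assms(5) by (simp add: card_Diff_subset n_def m_def)
      ultimately show ?thesis using mn by (simp add: of_nat_diff)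
    qed
    then have "real (\<Sum>v\<in>A. card (V - A - N v)) = (\<Sum>v\<in>A. (real n - real m) - real (card (N v)))"
      unfolding of_nat_sum by (intro sum.cong refl)
    then have D: "real (card (D N)) = real m * (real n - real m) - real h"
      unfolding cards(2) by (simp add: sum_subtractf h_def m_def)
    have NV: "u \<in> V" if "v \<in> A" "u \<in> N v" for u v using N that by blast
    have NA: "v \<notin> N v" if "v \<in> A" for v using N that by blast
    have HD: "H N \<subseteq> {e. e \<subseteq> V \<and> card e = 2}" "D N \<subseteq> {e. e \<subseteq> V \<and> card e = 2}"
      using assms(5) by (auto simp: H_def D_def card_insert_if NA dest: NV)
    define d where "d = real (card (D N)) * \<rho>"
    \<comment> \<open>Reading \<open>d\<close> as the probability that one object hits
      \<open>D N\<close> shows that it is at most 1.\<close>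
    have "d = measure_pmf.prob (binomial_subset_pmf V p) (D N)"
      using prob_binomial_subset_pairs[OF assms(1,3,4) HD(2)] by (simp add: d_def \<rho>_def)
    then have d: "0 \<le> d" "d \<le> 1" by auto
    have "measure_pmf.prob ?M (E N) \<le> r ^ h * (1 - d) ^ (card W - h)"
      using prob_hit_avoid_pairs_le[OF assms(1-4) HD] cards(1)
      by (simp add: E_def r_def d_def \<rho>_def)
    also have "(1 - d) ^ (card W - h) \<le> exp (- d) ^ (card W - h)"
      using d exp_ge_add_one_self[of "- d"] by (intro power_mono) auto
    also have "\<dots> = exp (- d * real (card W - h))"
      by (simp flip: exp_of_nat_mult add: mult.commute)
    \<comment> \<open>\<open>D N\<close> lacks \<open>h\<close> of the \<open>m * (n - m)\<close>
      pairs leaving \<open>A\<close>, and \<open>h\<close> objects are spent on \<open>H N\<close>.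
      Each of the two losses costs at most \<open>h\<close> in the exponent, whence a factor
      \<open>exp 2\<close> per hit pair.\<close>
    also have "\<dots> \<le> exp (2 * real h - real m * (real n - real m) * r)"
    proof -
      have "d * (real (card W) - real h) \<le> d * real (card W - h)"
        using d by (intro mult_left_mono) linarith+
      moreover have "d * (real (card W) - real h) = real m * (real n - real m) * r - real h * r - d * real h"
        by (simp add: d_def D r_def algebra_simps)
      moreover have "real h * r \<le> real h" using r by (intro mult_left_le) auto
      moreover have "d * real h \<le> real h" using d by (intro mult_left_le_one_le) auto
      ultimately show ?thesis unfolding exp_le_cancel_iff by linarith
    qed
    also have "r ^ h * exp (2 * real h - real m * (real n - real m) * r) =
        (r * exp 2) ^ h * exp (- (real n - real m) * r) ^ m"
    proof -
      have "exp (2 :: real) ^ h = exp (2 * real h)"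
        by (simp add: exp_of_nat_mult[symmetric] mult.commute)
      moreover have "exp (- (real n - real m) * r) ^ m = exp (- (real m * (real n - real m) * r))"
        unfolding exp_of_nat_mult[symmetric] by (simp add: algebra_simps)
      ultimately show ?thesis
        by (simp only: power_mult_distrib mult.assoc exp_add[symmetric]) simp
    qed
    also have "\<dots> = (\<Prod>v\<in>A. (r * exp 2) ^ card (N v) * exp (- (real n - real m) * r))"
      by (simp add: prod.distrib power_sum h_def m_def)
    finally show "measure_pmf.prob ?M (E N) \<le>
        (\<Prod>v\<in>A. (r * exp 2) ^ card (N v) * exp (- (real n - real m) * r))"
      using r(1) by (simp add: mult_left_mono)
  qed
  also have "\<dots> = (\<Prod>v\<in>A. \<Sum>B | B \<subseteq> V - A \<and> card B < k. (r * exp 2) ^ card B * exp (- (real n - real m) * r))"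
    unfolding Ns_def using finA finS by (subst prod_sum_PiE) auto
  also have "\<dots> \<le> (\<Prod>v\<in>A. real k * z ^ (k - 1) * exp (- (real n - real m) * r))"
  proof (rule prod_mono, rule conjI)
    have "real (card (V - A)) * (r * exp 2) \<le> real (card V) * (r * exp 2)"
      using r assms(1) by (intro mult_right_mono) (auto intro!: card_mono)
    then have "(\<Sum>B | B \<subseteq> V - A \<and> card B < k. (r * exp 2) ^ card B) \<le> real k * z ^ (k - 1)"
      using assms r by (intro sum_power_card_small_subsets_le) (auto simp: r_def)
    then show "(\<Sum>B | B \<subseteq> V - A \<and> card B < k. (r * exp 2) ^ card B * exp (- (real n - real m) * r))
        \<le> real k * z ^ (k - 1) * exp (- (real n - real m) * r)"
      unfolding sum_distrib_right[symmetric] by (intro mult_right_mono) auto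
  qed (use r in \<open>auto intro!: sum_nonneg\<close>)
  finally show ?thesis by (simp add: n_def m_def r_def)
qed

section \<open>Numerical estimates for the union bound over all sets\<close>

lemma power_over_fact_le_exp:
  fixes x :: real
  assumes "0 \<le> x"
  shows "x ^ m / fact m \<le> exp x"
proof -
  have "(\<Sum>i\<in>{m}. x ^ i /\<^sub>R fact i) \<le> (\<Sum>i. x ^ i /\<^sub>R fact i)"
    using assms by (intro sum_le_suminf summable_exp_generic) auto
  then show ?thesis by (simp add: exp_def divide_inverse mult.commute)
qed

text \<open>One term of the exponential series gives \<open>m ^ m / fact m \<le> exp m\<close>,
  which replaces the factorial in \<open>n ^ m / fact m\<close>.\<close>

lemma binomial_le_exp_power:
  assumes "1 \<le> m"
  shows "real (n choose m) \<le> (exp 1 * real n / real m) ^ m"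
proof -
  have "(n choose m) * fact m \<le> n ^ m" by (rule binomial_fact_pow)
  then have 1: "real (n choose m) * fact m \<le> real n ^ m"
    by (metis of_nat_fact of_nat_le_iff of_nat_mult of_nat_power)
  have "real m ^ m / fact m \<le> exp (real m)" by (rule power_over_fact_le_exp) simp
  then have 2: "real m ^ m \<le> exp (real m) * fact m" by (simp add: field_simps)
  have "real (n choose m) * real m ^ m \<le> real (n choose m) * (exp (real m) * fact m)"
    using 2 by (intro mult_left_mono) auto
  also have "\<dots> = real (n choose m) * fact m * exp (real m)" by simp
  also have "\<dots> \<le> real n ^ m * exp (real m)" using 1 by (intro mult_right_mono) auto
  also have "\<dots> = (exp 1 * real n) ^ m"
    by (simp add: power_mult_distrib exp_of_nat_mult[symmetric])
  finally show ?thesis using assms by (simp add: power_divide field_simps)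
qed

lemma sum_power_le_twice:
  fixes x :: real
  assumes "0 \<le> x" "x \<le> 1 / 2"
  shows "(\<Sum>m=1..n. x ^ m) \<le> 2 * x"
proof -
  \<comment> \<open>The subtracted term makes the induction close; equality holds at
    \<open>x = 1 / 2\<close>.\<close>
  have "(\<Sum>m=1..n. x ^ m) \<le> 2 * x - 2 * x * (1 / 2) ^ n"
  proof (induction n)
    case (Suc n)
    have "x * x ^ n \<le> x * (1 / 2) ^ n"
      using assms by (intro mult_left_mono power_mono) auto
    then show ?case using Suc by simp
  qed simp
  also have "\<dots> \<le> 2 * x" using assms by simp
  finally show ?thesis .
qed

text \<open>Here \<open>exp (n * s) = n * L ^ (k - 1) * exp a\<close>, so the power of
  \<open>L\<close> cancels. Since \<open>exp (m * s) \<le> exp 2 * m\<close>, a factor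
  \<open>m / n\<close> remains per node and cancels against the bound
  \<open>(exp 1 * n / m) ^ m\<close> for the number of sets. Of the constant \<open>exp 4\<close>,
  \<open>exp 2\<close> comes from \<open>exp (m * s)\<close>, and one \<open>exp 1\<close> each from
  the Bernoulli inequality and the binomial coefficient.\<close>

lemma set_count_times_isolation_le:
  fixes n m k P :: nat and p a :: real
  defines "s \<equiv> p\<^sup>2 * real P" and "L \<equiv> ln (real n)"
  assumes p: "0 \<le> p" "p \<le> 1" and "k \<ge> 1" "n \<ge> 2" "m \<ge> 1" "2 * m \<le> n"
    and ns: "real n * s = L + (real k - 1) * ln L + a"
    and L: "1 \<le> L"
    and "real n * p * (real n * s) \<le> 1"
    and half: "real n * s / 2 \<le> L - ln L" and "real n * s \<le> 2 * L"
  shows "real (n choose m) * (real k * (2 * exp 2 * L) ^ (k - 1) *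
      exp (- (real n - real m) * (real P * (p\<^sup>2 * (1 - p) ^ (n - 2))))) ^ m
    \<le> (real k * (2 * exp 2) ^ (k - 1) * exp 4 * exp (- a)) ^ m"
proof -
  let ?r = "real P * (p\<^sup>2 * (1 - p) ^ (n - 2))"
  have s0: "s \<ge> 0" using p by (simp add: s_def)
  \<comment> \<open>By Bernoulli's inequality the factor \<open>(1 - p) ^ (n - 2)\<close> lowers the
    exponent \<open>(n - m) * s\<close> by at most \<open>n * p * (n * s) \<le> 1\<close>.\<close>
  have "1 - real n * p \<le> 1 + real (n - 2) * (- p)"
    using p mult_right_mono[of "real (n - 2)" "real n" p] by simp
  also have "\<dots> \<le> (1 - p) ^ (n - 2)"
    using Bernoulli_inequality[of "- p" "n - 2"] p by simp
  finally have "s * (1 - real n * p) \<le> s * (1 - p) ^ (n - 2)"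
    using s0 by (rule mult_left_mono)
  also have "\<dots> = ?r" by (simp add: s_def)
  finally have "(real n - real m) * (s * (1 - real n * p)) \<le> (real n - real m) * ?r"
    using \<open>2 * m \<le> n\<close> by (intro mult_left_mono) auto
  moreover have "(real n - real m) * (s * (real n * p)) \<le> real n * (s * (real n * p))"
    using s0 p by (intro mult_right_mono) auto
  ultimately have "(real n - real m) * s - 1 \<le> (real n - real m) * ?r"
    using \<open>real n * p * (real n * s) \<le> 1\<close> by (simp add: algebra_simps)
  then have "- (real n - real m) * ?r \<le> 1 + real m * s - real n * s"
    by (simp add: algebra_simps)
  then have "exp (- (real n - real m) * ?r) \<le> exp (1 + real m * s - real n * s)" by simp
  also have "\<dots> = exp 1 * exp (real m * s) * (exp (- a) / (real n * L ^ (k - 1)))"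
  proof -
    have "exp L = real n" using \<open>n \<ge> 2\<close> by (simp add: L_def)
    moreover have "exp ((real k - 1) * ln L) = L ^ (k - 1)"
      using L \<open>k \<ge> 1\<close> exp_of_nat_mult[of "k - 1" "ln L"] by (simp add: of_nat_diff)
    ultimately have "exp (real n * s) = real n * L ^ (k - 1) * exp a"
      unfolding ns by (simp add: exp_add)
    then show ?thesis by (simp add: exp_diff exp_add exp_minus field_simps)
  qed
  finally have e0: "exp (- (real n - real m) * ?r) \<le>
      exp 1 * exp (real m * s) * (exp (- a) / (real n * L ^ (k - 1)))" .
  \<comment> \<open>If \<open>m * s > 2\<close>, then \<open>n * s \<le> 2 * L\<close> forces
    \<open>m \<ge> n / L\<close>, so \<open>ln m \<ge> L - ln L\<close>. By \<open>half\<close> this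
    is at least \<open>n * s / 2\<close>, which bounds \<open>m * s\<close> because
    \<open>2 * m \<le> n\<close>.\<close>
  have "exp (real m * s) \<le> exp 2 * real m"
  proof (cases "real m * s \<le> 2")
    case True
    have "exp (real m * s) * 1 \<le> exp 2 * real m"
      using True \<open>m \<ge> 1\<close> by (intro mult_mono) auto
    then show ?thesis by simp
  next
    case False
    have "real m * (real n * s) \<le> real m * (2 * L)"
      using \<open>real n * s \<le> 2 * L\<close> by (intro mult_left_mono) auto
    moreover have "2 * real n \<le> real n * (real m * s)"
      using False mult_left_mono[of 2 "real m * s" "real n"] by simp
    ultimately have "real n \<le> real m * L" by (simp add: algebra_simps)
    then have "real n / L \<le> real m" using L by (simp add: field_simps)
    then have "ln (real n / L) \<le> ln (real m)" using L \<open>n \<ge> 2\<close> \<open>m \<ge> 1\<close> by (subst ln_le_cancel_iff) auto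
    then have "L - ln L \<le> ln (real m)" using L \<open>n \<ge> 2\<close> by (simp add: ln_div L_def)
    moreover have "real m * s \<le> real n / 2 * s"
      using s0 \<open>2 * m \<le> n\<close> by (intro mult_right_mono) auto
    ultimately have "real m * s \<le> ln (real m)" using half by simp
    then have "exp (real m * s) \<le> real m" using \<open>m \<ge> 1\<close> by (simp add: ln_ge_iff)
    also have "\<dots> \<le> exp 2 * real m" using mult_right_mono[of 1 "exp 2" "real m"] by simp
    finally show ?thesis .
  qed
  then have "exp 1 * exp (real m * s) * (exp (- a) / (real n * L ^ (k - 1))) \<le>
      exp 1 * (exp 2 * real m) * (exp (- a) / (real n * L ^ (k - 1)))"
    using L by (intro mult_right_mono mult_left_mono) auto
  with e0 have e: "exp (- (real n - real m) * ?r) \<le>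
      exp 1 * (exp 2 * real m) * (exp (- a) / (real n * L ^ (k - 1)))"
    by (rule order_trans)
  let ?K = "real k * (2 * exp 2 * L) ^ (k - 1)"
  have "?K * exp (- (real n - real m) * ?r) \<le>
      ?K * (exp 1 * (exp 2 * real m) * (exp (- a) / (real n * L ^ (k - 1))))"
    using e L by (intro mult_left_mono) auto
  also have "\<dots> = real m / real n * (real k * (2 * exp 2) ^ (k - 1) * exp 3 * exp (- a))"
    using L \<open>n \<ge> 2\<close> by (simp add: power_mult_distrib field_simps exp_add[symmetric])
  finally have "(?K * exp (- (real n - real m) * ?r)) ^ m \<le>
      (real m / real n * (real k * (2 * exp 2) ^ (k - 1) * exp 3 * exp (- a))) ^ m"
    using L by (intro power_mono) auto
  then have "real (n choose m) * (?K * exp (- (real n - real m) * ?r)) ^ m \<le>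
      (exp 1 * real n / real m) ^ m *
      (real m / real n * (real k * (2 * exp 2) ^ (k - 1) * exp 3 * exp (- a))) ^ m"
    using L binomial_le_exp_power[OF \<open>m \<ge> 1\<close>] by (intro mult_mono) auto
  also have "\<dots> = (real k * (2 * exp 2) ^ (k - 1) * exp 4 * exp (- a)) ^ m"
  proof -
    have "exp 1 * real n / real m * (real m / real n * (real k * (2 * exp 2) ^ (k - 1) * exp 3 * exp (- a)))
       = real k * (2 * exp 2) ^ (k - 1) * (exp 1 * exp 3) * exp (- a)"
      using \<open>m \<ge> 1\<close> \<open>n \<ge> 2\<close> by (simp add: field_simps)
    also have "exp 1 * exp 3 = exp (4 :: real)" by (simp add: exp_add[symmetric])
    finally show ?thesis by (simp only: power_mult_distrib[symmetric])
  qed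
  finally show ?thesis .
qed

text \<open>The bad sets are grouped by size: size \<open>m\<close> contributes at most
  \<open>x ^ m\<close>, and the geometric sum is at most \<open>2 * x\<close>.\<close>

lemma prob_k_robust_ge:
  fixes n k P :: nat and p a :: real
  defines "s \<equiv> p\<^sup>2 * real P" and "L \<equiv> ln (real n)"
  defines "x \<equiv> real k * (2 * exp 2) ^ (k - 1) * exp 4 * exp (- a)"
  assumes p: "0 \<le> p" "p \<le> 1" and k: "k \<ge> 1" and n: "n \<ge> 2"
    and ns: "real n * s = L + (real k - 1) * ln L + a"
    and L: "1 \<le> L"
    and np: "real n * p * (real n * s) \<le> 1"
    and half: "real n * s / 2 \<le> L - ln L" and ns2: "real n * s \<le> 2 * L" and "s \<le> 1"
    and x: "x \<le> 1 / 2"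
  shows "1 - 2 * x \<le> measure_pmf.prob (binomial_rig n P p) {G. k_robust k G}"
proof -
  let ?V = "{1..n}" and ?W = "{..<P}"
  let ?M = "membership_pmf ?V ?W p"
  define \<rho> where "\<rho> = p\<^sup>2 * (1 - p) ^ (n - 2)"
  define F where "F A = {X. \<forall>v\<in>A. card {u \<in> ?V - A. \<exists>w\<in>?W. X w = {v, u}} < k}" for A :: "nat set"
  define As where "As = {A. A \<subseteq> ?V \<and> A \<noteq> {} \<and> 2 * card A \<le> n}"
  define t where "t m = (real k * (2 * exp 2 * L) ^ (k - 1) *
      exp (- (real n - real m) * (real P * \<rho>))) ^ m" for m
  have finAs: "finite As" unfolding As_def by (rule finite_subset[of _ "Pow ?V"]) auto
  have x0: "x \<ge> 0" by (simp add: x_def)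
  have Pr: "real P * \<rho> \<le> s"
    using p mult_left_mono[of "(1 - p) ^ (n - 2)" 1 s]
    by (simp add: \<rho>_def s_def power_le_one mult_ac)
  have "- {X. k_robust k (membership_graph ?V ?W X)} \<subseteq> (\<Union>A\<in>As. F A)"
  proof
    fix X assume X: "X \<in> - {X. k_robust k (membership_graph ?V ?W X)}"
    show "X \<in> (\<Union>A\<in>As. F A)"
    proof (rule ccontr)
      assume "X \<notin> (\<Union>A\<in>As. F A)"
      then have "k_robust k (membership_graph ?V ?W X)"
        by (intro k_robust_membership_graphI) (auto simp: As_def F_def not_less)
      then show False using X by simp
    qed
  qed
  then have "measure_pmf.prob ?M (- {X. k_robust k (membership_graph ?V ?W X)}) \<le>
      measure_pmf.prob ?M (\<Union>A\<in>As. F A)"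
    by (intro measure_pmf.finite_measure_mono) auto
  also have "\<dots> \<le> (\<Sum>A\<in>As. measure_pmf.prob ?M (F A))"
    using finAs by (intro measure_pmf.finite_measure_subadditive_finite) auto
  also have "\<dots> \<le> (\<Sum>A\<in>As. t (card A))"
  proof (rule sum_mono)
    fix A assume A: "A \<in> As"
    \<comment> \<open>The choice \<open>z = 2 * exp 2 * L\<close> in the bound for one set is
      dictated by \<open>n * (P * \<rho>) \<le> n * s \<le> 2 * L\<close>.\<close>
    have "(1::real) * 1 \<le> (2 * exp 2) * L" using L by (intro mult_mono) (auto intro: order_trans[of _ 2])
    moreover have "real n * (real P * \<rho> * exp 2) \<le> 2 * exp 2 * L"
    proof -
      have "real n * (real P * \<rho>) \<le> 2 * L"
        using ns2 mult_left_mono[OF Pr, of "real n"] by simp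
      then show ?thesis using mult_right_mono[of _ _ "exp 2 :: real"] by (fastforce simp: mult_ac)
    qed
    ultimately show "measure_pmf.prob ?M (F A) \<le> t (card A)"
      using prob_unreachable_set_le[of ?V ?W p A "2 * exp 2 * L" k] A p Pr \<open>s \<le> 1\<close>
      by (simp add: As_def F_def t_def \<rho>_def)
  qed
  also have "\<dots> \<le> (\<Sum>m=1..n. x ^ m)"
  proof -
    let ?I = "{m. 1 \<le> m \<and> 2 * m \<le> n}"
    have I: "finite ?I" "?I \<subseteq> {1..n}" by (auto intro: finite_subset[of _ "{1..n}"])
    have "As = (\<Union>m\<in>?I. {A. A \<subseteq> ?V \<and> card A = m})"
      by (auto simp: As_def Suc_le_eq card_gt_0_iff dest: finite_subset[of _ "{Suc 0..n}"])
    then have "(\<Sum>A\<in>As. t (card A)) = (\<Sum>m\<in>?I. \<Sum>A | A \<subseteq> ?V \<and> card A = m. t (card A))"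
      using I by (simp, subst sum.UNION_disjoint) auto
    also have "\<dots> = (\<Sum>m\<in>?I. real (n choose m) * t m)"
      using n_subsets[of ?V] by (intro sum.cong refl) simp
    also have "\<dots> \<le> (\<Sum>m\<in>?I. x ^ m)"
      unfolding t_def x_def \<rho>_def L_def
      using assms by (intro sum_mono set_count_times_isolation_le) auto
    also have "\<dots> \<le> (\<Sum>m=1..n. x ^ m)"
      using I x0 by (intro sum_mono2) auto
    finally show ?thesis .
  qed
  also have "\<dots> \<le> 2 * x" using x0 x by (rule sum_power_le_twice)
  finally have "measure_pmf.prob ?M (- {X. k_robust k (membership_graph ?V ?W X)}) \<le> 2 * x" .
  then have "1 - 2 * x \<le> measure_pmf.prob ?M {X. k_robust k (membership_graph ?V ?W X)}"
    using measure_pmf.prob_compl[of "{X. k_robust k (membership_graph ?V ?W X)}" ?M]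
    by (simp add: Compl_eq_Diff_UNIV)
  then show ?thesis using p by (simp add: binomial_rig_membership vimage_def)
qed

section \<open>The zero-law\<close>

text \<open>Let \<open>Y\<close> count the events that occur. Pointwise, \<open>2 / \<mu> * Y -
  Y\<^sup>2 / \<mu>\<^sup>2 = 1 - (1 - Y / \<mu>)\<^sup>2\<close> is at most 1 and vanishes where no
  event occurs; it remains to take expectations.\<close>

lemma prob_Union_ge_second_moment:
  fixes M :: "'a pmf"
  assumes "finite T" and pos: "0 < (\<Sum>t\<in>T. measure_pmf.prob M (E t))"
  defines "\<mu> \<equiv> \<Sum>t\<in>T. measure_pmf.prob M (E t)"
  shows "2 - (\<Sum>t\<in>T. \<Sum>t'\<in>T. measure_pmf.prob M (E t \<inter> E t')) / \<mu>\<^sup>2 \<le>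
    measure_pmf.prob M (\<Union>t\<in>T. E t)"
proof -
  define Y where "Y x = (\<Sum>t\<in>T. indicator (E t) x :: real)" for x
  have Y2: "Y x ^ 2 = (\<Sum>t\<in>T. \<Sum>t'\<in>T. indicator (E t \<inter> E t') x)" for x
    by (simp add: Y_def power2_eq_square sum_product indicator_inter_arith)
  have ind: "integrable M (indicat_real A)" for A
    by (rule integrable_real_indicator) (auto simp: less_top[symmetric])
  have intY: "integrable M Y" unfolding Y_def by (intro Bochner_Integration.integrable_sum ind)
  have intY2: "integrable M (\<lambda>x. Y x ^ 2)" unfolding Y2
    by (intro Bochner_Integration.integrable_sum ind)
  have EY: "measure_pmf.expectation M Y = \<mu>"
    unfolding Y_def \<mu>_def by (subst Bochner_Integration.integral_sum) (auto intro: ind)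
  have EY2: "measure_pmf.expectation M (\<lambda>x. Y x ^ 2) =
      (\<Sum>t\<in>T. \<Sum>t'\<in>T. measure_pmf.prob M (E t \<inter> E t'))"
    unfolding Y2 by (simp add: Bochner_Integration.integral_sum ind)
  have "2 - measure_pmf.expectation M (\<lambda>x. Y x ^ 2) / \<mu>\<^sup>2 =
      measure_pmf.expectation M (\<lambda>x. 2 / \<mu> * Y x - Y x ^ 2 / \<mu>\<^sup>2)"
    using intY intY2 pos by (simp add: EY \<mu>_def[symmetric])
  also have "\<dots> \<le> measure_pmf.expectation M (indicator (\<Union>t\<in>T. E t))"
  proof (intro integral_mono)
    fix x
    show "2 / \<mu> * Y x - Y x ^ 2 / \<mu>\<^sup>2 \<le> indicator (\<Union>t\<in>T. E t) x"
    proof (cases "x \<in> (\<Union>t\<in>T. E t)")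
      case True
      have "0 \<le> (1 - Y x / \<mu>)\<^sup>2" by simp
      then have "2 / \<mu> * Y x - Y x ^ 2 / \<mu>\<^sup>2 \<le> 1" by (simp add: power2_diff power_divide)
      then show ?thesis using True by simp
    next
      case False
      then have "Y x = 0" by (simp add: Y_def)
      then show ?thesis by simp
    qed
  qed (use intY intY2 ind in auto)
  finally show ?thesis by (simp add: EY2)
qed

section \<open>Nodes of small degree: sparse stars and their probabilities\<close>

lemma prob_binomial_subset_disjoint:
  assumes "finite V" "0 \<le> p" "p \<le> 1" "S \<subseteq> V"
  shows "measure_pmf.prob (binomial_subset_pmf V p) {T. T \<inter> S = {}} = (1 - p) ^ card S"
proof -
  let ?B = "\<lambda>v. if v \<in> S then {False} else UNIV"
  have "(\<lambda>f. {w \<in> V. f w}) -` {T. T \<inter> S = {}} = {f. \<forall>v\<in>V. f v \<in> ?B v}"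
    using assms(4) by (auto split: if_splits)
  then have "measure_pmf.prob (binomial_subset_pmf V p) {T. T \<inter> S = {}} =
      (\<Prod>v\<in>V. measure_pmf.prob (bernoulli_pmf p) (?B v))"
    using prob_Pi_pmf_Ball[OF assms(1), of False "\<lambda>_. bernoulli_pmf p" ?B]
    by (simp add: binomial_subset_pmf_def)
  also have "\<dots> = (\<Prod>v\<in>V. if v \<in> S then 1 - p else 1)"
    using assms by (intro prod.cong refl) (auto simp: measure_pmf_single)
  also have "\<dots> = (1 - p) ^ card S"
    using assms by (subst prod.If_cases) (auto simp: Int_absorb1)
  finally show ?thesis .
qed

lemma prob_binomial_subset_star:
  assumes "finite V" "0 \<le> p" "p \<le> 1" "U \<subseteq> V" "v \<in> V - U"
  shows "measure_pmf.prob (binomial_subset_pmf V p) ((\<lambda>x. {v, x}) ` U) =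
    real (card U) * (p\<^sup>2 * (1 - p) ^ (card V - 2))"
proof -
  have "inj_on (\<lambda>x. {v, x}) U" by (auto simp: inj_on_def doubleton_eq_iff)
  then have "card ((\<lambda>x. {v, x}) ` U) = card U" by (rule card_image)
  moreover have "(\<lambda>x. {v, x}) ` U \<subseteq> {e. e \<subseteq> V \<and> card e = 2}"
    using assms by (auto simp: card_insert_if)
  ultimately show ?thesis
    using prob_binomial_subset_pairs[OF assms(1-3)] by metis
qed

text \<open>The candidates \<open>v\<close> are taken outside \<open>U\<close>, while the neighbours are required to lie in \<open>U\<close>.
  Thus no object can serve as an edge of two different candidates, which is what makes the pair
  probabilities factor.\<close>

definition sparse_star :: "'b set \<Rightarrow> 'a set \<Rightarrow> 'a \<Rightarrow> 'b set \<Rightarrow> ('b \<Rightarrow> 'a set) set" where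
  "sparse_star W U v I = {X. \<forall>w\<in>W. X w \<in>
    (if w \<in> I then (\<lambda>x. {v, x}) ` U else {T. v \<notin> T \<or> T = {v}})}"

lemma prob_sparse_star:
  assumes "finite V" "finite W" "0 \<le> p" "p \<le> 1" "U \<subseteq> V" "v \<in> V - U" "I \<subseteq> W"
  shows "measure_pmf.prob (membership_pmf V W p) (sparse_star W U v I) =
    (real (card U) * (p\<^sup>2 * (1 - p) ^ (card V - 2))) ^ card I *
    (1 - p + p * (1 - p) ^ (card V - 1)) ^ (card W - card I)"
proof -
  let ?B = "binomial_subset_pmf V p"
  note 1 = prob_binomial_subset_star[OF assms(1,3-6)]
  have "{T. v \<notin> T \<or> T = {v}} = {T. T \<inter> {v} = {}} \<union> {{v}}" by auto
  then have "measure_pmf.prob ?B {T. v \<notin> T \<or> T = {v}} =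
      measure_pmf.prob ?B {T. T \<inter> {v} = {}} + measure_pmf.prob ?B {{v}}"
    by (simp only:) (rule measure_pmf.finite_measure_Union, auto)
  then have 2: "measure_pmf.prob ?B {T. v \<notin> T \<or> T = {v}} = 1 - p + p * (1 - p) ^ (card V - 1)"
    using prob_binomial_subset_disjoint[OF assms(1,3,4), of "{v}"] assms
    by (simp add: measure_pmf_single pmf_binomial_subset_card)
  have "measure_pmf.prob (membership_pmf V W p) (sparse_star W U v I) =
      (\<Prod>w\<in>W. measure_pmf.prob ?B (if w \<in> I then (\<lambda>x. {v, x}) ` U else {T. v \<notin> T \<or> T = {v}}))"
    unfolding membership_pmf_def sparse_star_def by (rule prob_Pi_pmf_Ball[OF assms(2)])
  also have "\<dots> = (\<Prod>w\<in>W. if w \<in> I then real (card U) * (p\<^sup>2 * (1 - p) ^ (card V - 2))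
      else 1 - p + p * (1 - p) ^ (card V - 1))"
  proof (rule prod.cong[OF refl])
    fix w
    show "measure_pmf.prob ?B (if w \<in> I then (\<lambda>x. {v, x}) ` U else {T. v \<notin> T \<or> T = {v}}) =
      (if w \<in> I then real (card U) * (p\<^sup>2 * (1 - p) ^ (card V - 2))
      else 1 - p + p * (1 - p) ^ (card V - 1))"
      by (cases "w \<in> I") (simp_all only: if_True if_False 1 2)
  qed
  finally show ?thesis unfolding prod_if_mem_subset[OF assms(2,7)] .
qed

text \<open>For equal centres, \<open>I\<close> can be read off from \<open>X\<close> as the set of
  objects that the centre shares with another node. For different centres, a common object would
  give \<open>{v, x} = {u, y}\<close> and put \<open>v\<close> into \<open>U\<close>.\<close>

lemma sparse_star_disjoint:
  assumes "(v, I) \<noteq> (u, J)" "v \<notin> U" "u \<notin> U" "I \<subseteq> W" "J \<subseteq> W"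
    and "u = v \<or> I \<inter> J \<noteq> {}"
  shows "sparse_star W U v I \<inter> sparse_star W U u J = {}"
proof (rule ccontr)
  assume "sparse_star W U v I \<inter> sparse_star W U u J \<noteq> {}"
  then obtain X where X: "X \<in> sparse_star W U v I" "X \<in> sparse_star W U u J" by blast
  show False
  proof (cases "u = v")
    case True
    then have "I \<noteq> J" using assms(1) by auto
    have "I = {w \<in> W. v \<in> X w \<and> X w \<noteq> {v}}" "J = {w \<in> W. v \<in> X w \<and> X w \<noteq> {v}}"
      using X assms(2-5) True by (auto simp: sparse_star_def split: if_splits)
    then show False using \<open>I \<noteq> J\<close> by simp
  next
    case False
    then obtain w where w: "w \<in> I" "w \<in> J" using assms(6) by auto
    then obtain x y where "x \<in> U" "y \<in> U" "X w = {v, x}" "X w = {u, y}"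
      using X assms(4) unfolding sparse_star_def by fastforce
    then show False using False assms(2,3) by (auto simp: doubleton_eq_iff)
  qed
qed

text \<open>Distinct stars with the same centre or a common object exclude each other. Otherwise
  \<open>I\<close> and \<open>J\<close> are disjoint, and the probability factors over the objects,
  \<open>2 * j\<close> of them being of star type.\<close>

lemma prob_sparse_star_pair_le:
  assumes "finite V" "finite W" "0 \<le> p" "p \<le> 1" "U \<subseteq> V" "v \<in> V - U" "u \<in> V - U"
    and "I \<subseteq> W" "J \<subseteq> W" "card I = j" "card J = j" "(v, I) \<noteq> (u, J)"
  shows "measure_pmf.prob (membership_pmf V W p) (sparse_star W U v I \<inter> sparse_star W U u J) \<le>
    (real (card U) * (p\<^sup>2 * (1 - p) ^ (card V - 2))) ^ (2 * j) *
    ((1 - p)\<^sup>2 + 2 * p * (1 - p) ^ (card V - 1)) ^ (card W - 2 * j)"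
proof (cases "u = v \<or> I \<inter> J \<noteq> {}")
  case True
  have "sparse_star W U v I \<inter> sparse_star W U u J = {}"
    by (rule sparse_star_disjoint) (use assms True in auto)
  then show ?thesis using assms by simp
next
  case False
  let ?B = "binomial_subset_pmf V p"
  let ?b = "real (card U) * (p\<^sup>2 * (1 - p) ^ (card V - 2))"
  let ?a = "(1 - p)\<^sup>2 + 2 * p * (1 - p) ^ (card V - 1)"
  let ?N = "{T. (v \<notin> T \<or> T = {v}) \<and> (u \<notin> T \<or> T = {u})}"
  \<comment> \<open>On \<open>I\<close> only the condition from \<open>v\<close> is kept, on
    \<open>J\<close> only that from \<open>u\<close>; an upper bound is enough.\<close>
  let ?S = "\<lambda>w. if w \<in> I then (\<lambda>x. {v, x}) ` U else if w \<in> J then (\<lambda>x. {u, x}) ` U else ?N"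
  have finIJ: "finite I" "finite J" using assms finite_subset by metis+
  note 1 = prob_binomial_subset_star[OF assms(1,3-5)]
  have uv: "u \<noteq> v" using False by simp
  \<comment> \<open>An object outside both stars avoids both centres, or one of them is its only
    holder.\<close>
  then have "?N = {T. T \<inter> {u, v} = {}} \<union> {{u}, {v}}" by auto
  then have "measure_pmf.prob ?B ?N =
      measure_pmf.prob ?B {T. T \<inter> {u, v} = {}} + measure_pmf.prob ?B {{u}, {v}}"
    by (simp only:) (rule measure_pmf.finite_measure_Union, auto)
  also have "measure_pmf.prob ?B {{u}, {v}} = 2 * p * (1 - p) ^ (card V - 1)"
    using assms uv by (simp add: measure_measure_pmf_finite pmf_binomial_subset_card)
  finally have 2: "measure_pmf.prob ?B ?N = ?a"
    using prob_binomial_subset_disjoint[OF assms(1,3,4), of "{u, v}"] assms uv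
    by (simp add: power2_eq_square)
  have "sparse_star W U v I \<inter> sparse_star W U u J \<subseteq> {X. \<forall>w\<in>W. X w \<in> ?S w}"
    by (auto simp: sparse_star_def)
  then have "measure_pmf.prob (membership_pmf V W p) (sparse_star W U v I \<inter> sparse_star W U u J) \<le>
      measure_pmf.prob (membership_pmf V W p) {X. \<forall>w\<in>W. X w \<in> ?S w}"
    by (intro measure_pmf.finite_measure_mono) auto
  also have "\<dots> = (\<Prod>w\<in>W. measure_pmf.prob ?B (?S w))"
    unfolding membership_pmf_def by (rule prob_Pi_pmf_Ball[OF assms(2)])
  also have "\<dots> = (\<Prod>w\<in>W. if w \<in> I \<union> J then ?b else ?a)"
  proof (rule prod.cong[OF refl])
    fix w
    show "measure_pmf.prob ?B (?S w) = (if w \<in> I \<union> J then ?b else ?a)"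
      by (cases "w \<in> I"; cases "w \<in> J")
        (simp_all only: if_True if_False Un_iff simp_thms 1[OF assms(6)] 1[OF assms(7)] 2)
  qed
  also have "\<dots> = ?b ^ card (I \<union> J) * ?a ^ (card W - card (I \<union> J))"
    using assms(2,8,9) by (intro prod_if_mem_subset) auto
  also have "card (I \<union> J) = 2 * j"
    using False assms(10,11) finIJ by (subst card_Un_disjoint) auto
  finally show ?thesis .
qed

text \<open>Every neighbour of \<open>v\<close> shares an object of \<open>I\<close> with it, and
  each such object has at most one further holder. So \<open>v\<close> has degree at most
  \<open>card I\<close>, too small for a robust graph.\<close>

lemma sparse_star_not_k_robust:
  assumes "finite V" "finite W" "v \<in> V" "card V \<ge> 2" "I \<subseteq> W" "card I < k" "X \<in> sparse_star W U v I"
  shows "\<not> k_robust k (membership_graph V W X)"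
proof
  have X: "\<exists>x. X w = {v, x}" if "w \<in> I" for w
  proof -
    have "X w \<in> (if w \<in> I then (\<lambda>x. {v, x}) ` U else {T. v \<notin> T \<or> T = {v}})"
      using assms(5,7) that unfolding sparse_star_def by blast
    then show ?thesis using that by auto
  qed
  have "finite I" using assms(2,5) finite_subset by blast
  assume "k_robust k (membership_graph V W X)"
  then have "k \<le> card (neighbors_in (membership_graph V W X) (V - {v}) v)"
    using assms unfolding membership_graph_def by (intro k_robust_imp_degree_ge)
  also have "\<dots> \<le> card (\<Union>w\<in>I. X w - {v})"
  proof (rule card_mono)
    have "finite (X w - {v})" if "w \<in> I" for w using X[OF that] by (metis finite.emptyI finite_insert finite_Diff)
    then show "finite (\<Union>w\<in>I. X w - {v})" using \<open>finite I\<close> by blast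
    show "neighbors_in (membership_graph V W X) (V - {v}) v \<subseteq> (\<Union>w\<in>I. X w - {v})"
    proof
      fix u assume "u \<in> neighbors_in (membership_graph V W X) (V - {v}) v"
      then obtain w where w: "w \<in> W" "u \<in> X w" "v \<in> X w" "u \<noteq> v"
        unfolding membership_graph_def neighbors_in_intersection_graph by blast
      moreover have "w \<in> I"
      proof (rule ccontr)
        assume "w \<notin> I"
        then have "v \<notin> X w \<or> X w = {v}" using assms(7) w(1) by (auto simp: sparse_star_def)
        then show False using w by auto
      qed
      ultimately show "u \<in> (\<Union>w\<in>I. X w - {v})" by blast
    qed
  qed
  also have "\<dots> \<le> (\<Sum>w\<in>I. card (X w - {v}))"
    using \<open>finite I\<close> by (rule card_UN_le)
  also have "\<dots> \<le> (\<Sum>w\<in>I. 1)"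
  proof (rule sum_mono)
    fix w assume "w \<in> I"
    then obtain x where "X w = {v, x}" using X by blast
    then have "X w - {v} \<subseteq> {x}" by auto
    from card_mono[OF _ this] show "card (X w - {v}) \<le> 1" by simp
  qed
  finally show False using assms(6) by simp
qed

text \<open>Second moment over the pairs \<open>(v, I)\<close>, with centres in the lower half and
  partners in the upper half. The diagonal yields \<open>1 / \<mu>\<close>. The other pairs yield
  the joint bound divided by the squared single probability, where the powers of \<open>b\<close>
  cancel.\<close>

lemma prob_k_robust_le:
  fixes n k P :: nat and p :: real
  defines "j \<equiv> k - 1"
  defines "b \<equiv> real (n - n div 2) * (p\<^sup>2 * (1 - p) ^ (n - 2))"
    and "a \<equiv> 1 - p + p * (1 - p) ^ (n - 1)"
    and "a2 \<equiv> (1 - p)\<^sup>2 + 2 * p * (1 - p) ^ (n - 1)"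
  defines "\<mu> \<equiv> real (n div 2) * real (P choose j) * b ^ j * a ^ (P - j)"
  assumes p: "0 \<le> p" "p \<le> 1" and n: "n \<ge> 2" and k: "k \<ge> 1" and "\<mu> > 0"
  shows "measure_pmf.prob (binomial_rig n P p) {G. k_robust k G} \<le>
    1 / \<mu> + (a2 ^ (P - 2 * j) / a ^ (2 * (P - j)) - 1)"
proof -
  let ?V = "{1..n}" and ?W = "{..<P}" and ?V1 = "{1..n div 2}" and ?U = "{n div 2 + 1..n}"
  let ?M = "membership_pmf ?V ?W p"
  define T where "T = ?V1 \<times> {I. I \<subseteq> ?W \<and> card I = j}"
  define E where "E = (\<lambda>(v, I). sparse_star ?W ?U v I)"
  define Q where "Q = b ^ (2 * j) * a2 ^ (P - 2 * j)"
  have "finite {I. I \<subseteq> ?W \<and> card I = j}" by (rule finite_subset[of _ "Pow ?W"]) auto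
  then have finT: "finite T" by (simp add: T_def)
  have cardT: "real (card T) = real (n div 2) * real (P choose j)"
    by (simp add: T_def card_cartesian_product n_subsets)
  have PE: "measure_pmf.prob ?M (E t) = b ^ j * a ^ (P - j)" if "t \<in> T" for t
  proof -
    obtain v I where t: "t = (v, I)" by force
    have "measure_pmf.prob ?M (sparse_star ?W ?U v I) =
      (real (card ?U) * (p\<^sup>2 * (1 - p) ^ (card ?V - 2))) ^ card I *
      (1 - p + p * (1 - p) ^ (card ?V - 1)) ^ (card ?W - card I)"
      using that p by (intro prob_sparse_star) (auto simp: t T_def)
    then show ?thesis using that by (simp add: t T_def E_def b_def a_def)
  qed
  then have sumE: "(\<Sum>t\<in>T. measure_pmf.prob ?M (E t)) = \<mu>"
    by (simp add: cardT \<mu>_def)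
  \<comment> \<open>The diagonal term is put on top of \<open>Q\<close>, not in its place, so that
    the double sum is bounded by \<open>\<mu> + (card T)\<^sup>2 * Q\<close>.\<close>
  have pair: "measure_pmf.prob ?M (E t \<inter> E t') \<le> (if t = t' then b ^ j * a ^ (P - j) else 0) + Q"
    if "t \<in> T" "t' \<in> T" for t t'
  proof (cases "t = t'")
    case True
    have "Q \<ge> 0" using p by (simp add: Q_def b_def a2_def)
    then show ?thesis using PE[OF that(1)] True by simp
  next
    case False
    obtain v I u J where t: "t = (v, I)" "t' = (u, J)" by force
    have "measure_pmf.prob ?M (sparse_star ?W ?U v I \<inter> sparse_star ?W ?U u J) \<le>
      (real (card ?U) * (p\<^sup>2 * (1 - p) ^ (card ?V - 2))) ^ (2 * j) *
      ((1 - p)\<^sup>2 + 2 * p * (1 - p) ^ (card ?V - 1)) ^ (card ?W - 2 * j)"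
      using that p False by (intro prob_sparse_star_pair_le) (auto simp: t T_def)
    then show ?thesis unfolding if_not_P[OF False] by (simp add: t E_def Q_def b_def a2_def)
  qed
  have "(\<Sum>t\<in>T. \<Sum>t'\<in>T. measure_pmf.prob ?M (E t \<inter> E t')) \<le>
      (\<Sum>t\<in>T. \<Sum>t'\<in>T. (if t = t' then b ^ j * a ^ (P - j) else 0) + Q)"
    using pair by (intro sum_mono)
  also have "\<dots> = \<mu> + (real (card T))\<^sup>2 * Q"
    using finT by (simp add: sum.distrib sum.delta cardT \<mu>_def power2_eq_square algebra_simps)
  finally have "(\<Sum>t\<in>T. \<Sum>t'\<in>T. measure_pmf.prob ?M (E t \<inter> E t')) / \<mu>\<^sup>2 \<le>
      (\<mu> + (real (card T))\<^sup>2 * Q) / \<mu>\<^sup>2" by (rule divide_right_mono) simp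
  also have "\<dots> = 1 / \<mu> + a2 ^ (P - 2 * j) / a ^ (2 * (P - j))"
  proof -
    have "\<mu> = real (card T) * b ^ j * a ^ (P - j)" by (simp add: \<mu>_def cardT)
    then have mu2: "\<mu>\<^sup>2 = (real (card T))\<^sup>2 * b ^ (2 * j) * a ^ (2 * (P - j))"
      by (simp only: power_mult_distrib power_mult[symmetric] mult.commute[of 2])
    then have c: "(real (card T))\<^sup>2 * b ^ (2 * j) \<noteq> 0"
      using \<open>\<mu> > 0\<close> by (metis less_irrefl mult_zero_left zero_less_power)
    have "(real (card T))\<^sup>2 * Q / \<mu>\<^sup>2 = a2 ^ (P - 2 * j) / a ^ (2 * (P - j))"
      unfolding Q_def mu2 mult.assoc[symmetric] using c by (rule mult_divide_mult_cancel_left)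
    moreover have "\<mu> / \<mu>\<^sup>2 = 1 / \<mu>" by (simp add: power2_eq_square)
    ultimately show ?thesis by (simp add: add_divide_distrib)
  qed
  finally have "2 - (1 / \<mu> + a2 ^ (P - 2 * j) / a ^ (2 * (P - j))) \<le> measure_pmf.prob ?M (\<Union>t\<in>T. E t)"
    using prob_Union_ge_second_moment[OF finT, of ?M E] \<open>\<mu> > 0\<close> unfolding sumE by linarith
  also have "\<dots> \<le> measure_pmf.prob ?M (- {X. k_robust k (membership_graph ?V ?W X)})"
  proof (rule measure_pmf.finite_measure_mono)
    show "(\<Union>t\<in>T. E t) \<subseteq> - {X. k_robust k (membership_graph ?V ?W X)}"
    proof (clarify)
      fix X v I assume "(v, I) \<in> T" "X \<in> E (v, I)" "k_robust k (membership_graph ?V ?W X)"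
      moreover from this have "v \<le> n div 2" by (simp add: T_def)
      then have "v \<le> n" by linarith
      ultimately show False
        using sparse_star_not_k_robust[of ?V ?W v I k X ?U] n k by (auto simp: T_def E_def j_def)
    qed
  qed simp
  also have "\<dots> = 1 - measure_pmf.prob ?M {X. k_robust k (membership_graph ?V ?W X)}"
    using measure_pmf.prob_compl[of "{X. k_robust k (membership_graph ?V ?W X)}" ?M]
    by (simp add: Compl_eq_Diff_UNIV)
  finally show ?thesis using p by (simp add: binomial_rig_membership vimage_def)
qed

section \<open>Estimates for the two terms of the second moment bound\<close>

lemma sparse_star_correlation_le:
  fixes n P j :: nat and p :: real
  assumes p: "0 \<le> p" "p \<le> 1 / 2" and "2 * j \<le> P"
  shows "((1 - p)\<^sup>2 + 2 * p * (1 - p) ^ (n - 1)) ^ (P - 2 * j) /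
      (1 - p + p * (1 - p) ^ (n - 1)) ^ (2 * (P - j))
    \<le> exp (8 * (p\<^sup>2 * real P)) / (1 - p) ^ (2 * j)"
proof -
  define q where "q = (1 - p) ^ (n - 1)"
  define a a2 where "a = 1 - p + p * q" and "a2 = (1 - p)\<^sup>2 + 2 * p * q"
  have q: "0 \<le> q" "q \<le> 1" using p by (auto simp: q_def power_le_one)
  have a: "1 - p \<le> a" "1 / 2 \<le> a" using p mult_nonneg_nonneg[OF p(1) q(1)] unfolding a_def by linarith+
  have a2: "0 \<le> a2" using p q by (simp add: a2_def)
  \<comment> \<open>The correlation of two centres is of second order: \<open>a2\<close> exceeds
    \<open>a\<^sup>2\<close> by at most \<open>2 * p\<^sup>2\<close>, and
    \<open>1 / 2 \<le> a\<close> turns this into a relative error of at most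
    \<open>8 * p\<^sup>2\<close>.\<close>
  have "a2 = a\<^sup>2 + 2 * p\<^sup>2 * q - p\<^sup>2 * q\<^sup>2" by (simp add: a_def a2_def power2_eq_square algebra_simps)
  also have "\<dots> \<le> a\<^sup>2 + 2 * p\<^sup>2"
  proof -
    have "2 * p\<^sup>2 * q \<le> 2 * p\<^sup>2 * 1" using q by (intro mult_left_mono) auto
    moreover have "0 \<le> p\<^sup>2 * q\<^sup>2" by simp
    ultimately show ?thesis by linarith
  qed
  finally have "a2 / a\<^sup>2 \<le> 1 + 2 * p\<^sup>2 / a\<^sup>2" using a by (simp add: field_simps)
  also have "2 * p\<^sup>2 / a\<^sup>2 \<le> 2 * p\<^sup>2 / (1 / 2)\<^sup>2"
    using a by (intro divide_left_mono power_mono mult_pos_pos zero_less_power) auto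
  also have "1 + 2 * p\<^sup>2 / (1 / 2)\<^sup>2 = 1 + 8 * p\<^sup>2" by (simp add: power2_eq_square)
  also have "\<dots> \<le> exp (8 * p\<^sup>2)" by (rule exp_ge_add_one_self)
  finally have r: "a2 / a\<^sup>2 \<le> exp (8 * p\<^sup>2)" by simp
  \<comment> \<open>The denominator has \<open>2 * j\<close> further factors \<open>a\<close>,
    because a single star leaves out only its own \<open>j\<close> objects; each is at least
    \<open>1 - p\<close>.\<close>
  have "2 * (P - j) = 2 * (P - 2 * j) + 2 * j" using assms(3) by simp
  then have "a2 ^ (P - 2 * j) / a ^ (2 * (P - j)) = (a2 / a\<^sup>2) ^ (P - 2 * j) / a ^ (2 * j)"
    by (simp add: power_add power_mult power_divide)
  also have "\<dots> \<le> exp (8 * p\<^sup>2) ^ (P - 2 * j) / (1 - p) ^ (2 * j)"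
    using r a a2 p by (intro frac_le power_mono) auto
  also have "\<dots> \<le> exp (8 * p\<^sup>2) ^ P / (1 - p) ^ (2 * j)"
    using p by (intro divide_right_mono power_increasing) auto
  also have "exp (8 * p\<^sup>2) ^ P = exp (8 * (p\<^sup>2 * real P))"
    by (simp add: exp_of_nat_mult[symmetric] mult_ac)
  finally show ?thesis by (simp add: a_def a2_def q_def)
qed

text \<open>Choosing the star objects and partners gives at least a constant times
  \<open>L ^ j\<close>, and the remaining objects give at least \<open>exp (- 1 - n * s)\<close>.
  Together with the at least \<open>n / 3\<close> centres this cancels against
  \<open>exp (n * s) = n * L ^ j * exp \<beta>\<close>.\<close>

lemma expected_sparse_stars_ge:
  fixes n k P :: nat and p \<beta> :: real
  defines "s \<equiv> p\<^sup>2 * real P" and "L \<equiv> ln (real n)" and "j \<equiv> k - 1"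
  defines "b \<equiv> real (n - n div 2) * (p\<^sup>2 * (1 - p) ^ (n - 2))"
    and "a \<equiv> 1 - p + p * (1 - p) ^ (n - 1)"
  assumes p: "0 \<le> p" "p \<le> 1" and n: "n \<ge> 2" and k: "k \<ge> 1" and L: "1 \<le> L" and P: "j \<le> P"
    and ns: "real n * s = L + (real k - 1) * ln L + \<beta>"
    and ns_ge: "L / 2 \<le> real n * s"
    and np: "real n * p \<le> 1 / 2" and nps: "real n * p * (real n * s) \<le> 1 / 2"
  shows "exp (- \<beta>) / (3 * exp 1 * (8 * real j) ^ j) \<le>
    real (n div 2) * real (P choose j) * b ^ j * a ^ (P - j)"
proof -
  have s0: "0 \<le> s" using p by (simp add: s_def)
  have "1 - real n * p \<le> 1 + real (n - 2) * (- p)"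
    using p mult_right_mono[of "real (n - 2)" "real n" p] by simp
  also have "\<dots> \<le> (1 - p) ^ (n - 2)"
    using Bernoulli_inequality[of "- p" "n - 2"] p by simp
  finally have q2: "1 / 2 \<le> (1 - p) ^ (n - 2)" using np by simp
  have "real n / 2 * (p\<^sup>2 * (1 / 2)) \<le> b"
    unfolding b_def using q2 p by (intro mult_mono) auto
  then have b: "real n * p\<^sup>2 / 4 \<le> b" by simp
  then have b0: "0 \<le> b" using p by (intro order_trans[OF _ b]) auto
  \<comment> \<open>For \<open>j = 0\<close> the divisions yield 0, but powers with exponent 0 are
    1, so no separate case arises.\<close>
  have stars: "L ^ j / (8 * real j) ^ j \<le> real (P choose j) * b ^ j"
  proof -
    have "L / (8 * real j) \<le> real n * s / (4 * real j)"
      using ns_ge divide_right_mono[of "L / 2" "real n * s" "4 * real j"] by simp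
    also have "\<dots> = real P / real j * (real n * p\<^sup>2 / 4)" by (simp add: s_def mult_ac)
    also have "\<dots> \<le> real P / real j * b" using b by (intro mult_left_mono) auto
    finally have "(L / (8 * real j)) ^ j \<le> (real P / real j * b) ^ j"
      using L by (intro power_mono) auto
    also have "\<dots> = (real P / real j) ^ j * b ^ j" by (rule power_mult_distrib)
    also have "\<dots> \<le> real (P choose j) * b ^ j"
      using binomial_ge_n_over_k_pow_k[OF P, where 'a = real] b0 by (intro mult_right_mono) auto
    finally show ?thesis by (simp add: power_divide)
  qed
  \<comment> \<open>\<open>1 - a\<close> is the probability that an object is held by a given node
    and by some other node; \<open>x\<close> will bound it.\<close>
  define x where "x = real n * p\<^sup>2"
  have "p * (real n * p) \<le> 1 * (1 / 2)" using p np by (intro mult_mono) auto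
  then have x: "0 \<le> x" "x \<le> 1 / 2" using p by (auto simp: x_def power2_eq_square mult_ac)
  have "1 - real n * p \<le> 1 + real (n - 1) * (- p)"
    using p mult_right_mono[of "real (n - 1)" "real n" p] by simp
  also have "\<dots> \<le> (1 - p) ^ (n - 1)"
    using Bernoulli_inequality[of "- p" "n - 1"] p by simp
  finally have "p * (1 - real n * p) \<le> p * (1 - p) ^ (n - 1)" using p(1) by (rule mult_left_mono)
  then have ax: "1 - x \<le> a" by (simp add: a_def x_def power2_eq_square algebra_simps)
  have "p * (1 - p) ^ (n - 1) \<le> p * 1" using p by (intro mult_left_mono power_le_one) auto
  then have a1: "a \<le> 1" by (simp add: a_def)
  \<comment> \<open>Over all \<open>P\<close> objects the quadratic error in
    \<open>ln (1 - x)\<close> totals \<open>2 * p * (n * p) * (n * s) \<le> 1\<close>, which is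
    absorbed by \<open>exp (- 1)\<close>.\<close>
  have "exp (- 1) * exp (- (real n * s)) \<le> exp (- x - 2 * x\<^sup>2) ^ P"
  proof -
    have "real P * x = real n * s" by (simp add: x_def s_def)
    moreover have "real P * (2 * x\<^sup>2) = 2 * (p * (real n * p * (real n * s)))"
      by (simp add: x_def s_def power2_eq_square)
    moreover have "p * (real n * p * (real n * s)) \<le> 1 * (1 / 2)"
      using p nps s0 by (intro mult_mono) auto
    ultimately have "- 1 - real n * s \<le> real P * (- x - 2 * x\<^sup>2)"
      by (simp add: algebra_simps)
    then show ?thesis by (simp add: exp_of_nat_mult[symmetric] exp_add[symmetric])
  qed
  also have "\<dots> \<le> (1 - x) ^ P"
  proof (rule power_mono)
    have "- x - 2 * x\<^sup>2 \<le> ln (1 - x)" using x by (intro ln_one_minus_pos_lower_bound)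
    then show "exp (- x - 2 * x\<^sup>2) \<le> 1 - x" using x by (simp add: ln_ge_iff)
  qed simp
  also have "\<dots> \<le> a ^ P" using ax x by (intro power_mono) auto
  also have "\<dots> \<le> a ^ (P - j)" using ax x a1 by (intro power_decreasing) auto
  finally have aP: "exp (- 1) * exp (- (real n * s)) \<le> a ^ (P - j)" .
  have "n \<le> 3 * (n div 2)" using n by presburger
  then have "real n / 3 \<le> real (n div 2)" by linarith
  then have "real n / 3 * (L ^ j / (8 * real j) ^ j) * (exp (- 1) * exp (- (real n * s))) \<le>
      real (n div 2) * (real (P choose j) * b ^ j) * a ^ (P - j)"
    using stars aP L b0 by (intro mult_mono) auto
  moreover have "real n / 3 * (L ^ j / (8 * real j) ^ j) * (exp (- 1) * exp (- (real n * s))) =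
      exp (- \<beta>) / (3 * exp 1 * (8 * real j) ^ j)"
  proof -
    have "exp L = real n" using n by (simp add: L_def)
    moreover have "exp ((real k - 1) * ln L) = L ^ j"
      using L k exp_of_nat_mult[of j "ln L"] by (simp add: j_def of_nat_diff)
    ultimately have "exp (real n * s) = real n * L ^ j * exp \<beta>"
      unfolding ns by (simp add: exp_add)
    then show ?thesis using n L by (simp add: exp_minus field_simps)
  qed
  ultimately show ?thesis by (simp add: mult.assoc)
qed

section \<open>The threshold\<close>

text \<open>\<open>q\<close> is the value of \<open>p\<close> that realises \<open>\<beta>\<close>
  exactly. The exponent 5 matters in \<open>(n * q * N)\<^sup>2 = n * N ^ 3 / P\<close>: as
  \<open>N\<close> is at most \<open>2 * ln n\<close>, this is of order at most
  \<open>1 / (ln n)\<^sup>2\<close>.\<close>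

lemma eventually_threshold_scale:
  fixes k :: nat and P :: "nat \<Rightarrow> nat" and \<beta> :: "nat \<Rightarrow> real"
  defines "N \<equiv> \<lambda>n. ln (real n) + (real k - 1) * ln (ln (real n)) + \<beta> n"
  defines "q \<equiv> \<lambda>n. sqrt (N n / real n / real (P n))"
  assumes k: "k \<ge> 1"
    and growth: "(\<lambda>n. real (P n)) \<in> \<Omega>(\<lambda>n. real n * ln (real n) ^ 5)"
    and beta: "eventually (\<lambda>n. \<bar>\<beta> n\<bar> \<le> ln (ln (real n))) sequentially"
  shows "eventually (\<lambda>n. n \<ge> 2 \<and> 1 \<le> ln (real n) \<and> 2 * k \<le> P n \<and>
      real n * ((q n)\<^sup>2 * real (P n)) = N n \<and>
      ln (real n) / 2 \<le> N n \<and> N n \<le> 2 * ln (real n) \<and> N n / 2 \<le> ln (real n) - ln (ln (real n)) \<and>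
      (q n)\<^sup>2 * real (P n) \<le> 2 * ln (real n) / real n \<and> (q n)\<^sup>2 * real (P n) \<le> 1 \<and>
      0 \<le> q n \<and> real n * q n \<le> 1 / 2 \<and> real n * q n * N n \<le> 1 / 2) sequentially"
proof -
  obtain c where c: "c > 0"
    and ev: "eventually (\<lambda>n. norm (real (P n)) \<ge> c * norm (real n * ln (real n) ^ 5)) sequentially"
    using growth by (rule landau_omega.bigE)
  \<comment> \<open>This makes the iterated logarithms small enough for all three bounds on
    \<open>N n\<close>.\<close>
  have "eventually (\<lambda>n::nat. (real k + 2) * ln (ln (real n)) \<le> ln (real n) / 2) sequentially"
    by real_asymp
  moreover have "eventually (\<lambda>n::nat. 2 \<le> ln (real n)) sequentially" by real_asymp
  \<comment> \<open>The constant 32 makes \<open>8 / (c * L\<^sup>2)\<close> at most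
    \<open>1 / 4\<close>.\<close>
  moreover have "eventually (\<lambda>n::nat. 32 / c \<le> ln (real n) ^ 2) sequentially" by real_asymp
  moreover have "eventually (\<lambda>n::nat. 2 * real k / c \<le> real n) sequentially" by real_asymp
  moreover have "eventually (\<lambda>n::nat. 2 * ln (real n) \<le> real n) sequentially" by real_asymp
  ultimately show ?thesis
    using ev beta eventually_ge_at_top[of 2]
  proof eventually_elim
    case (elim n)
    define L l where "L = ln (real n)" and "l = ln L"
    have L2: "2 \<le> L" and kl: "(real k + 2) * l \<le> L / 2" and Lc: "32 / c \<le> L ^ 2"
      and cn: "2 * real k / c \<le> real n" and Ln: "2 * L \<le> real n" and bl: "\<bar>\<beta> n\<bar> \<le> l"
      and Pc: "c * (real n * L ^ 5) \<le> real (P n)" and n2: "n \<ge> 2"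
      using elim by (auto simp: L_def l_def abs_mult)
    have l0: "0 \<le> l" using L2 by (simp add: l_def)
    have N: "N n = L + (real k - 1) * l + \<beta> n" by (simp add: N_def L_def l_def)
    have "l \<le> real k * l" using k l0 mult_right_mono[of 1 "real k" l] by simp
    moreover have "real k * l + 2 * l \<le> L / 2" using kl by (simp add: distrib_right)
    moreover have "N n = L + real k * l - l + \<beta> n" unfolding N by (simp add: algebra_simps)
    ultimately have N1: "L / 2 \<le> N n" and N2: "N n \<le> 2 * L" and N3: "N n / 2 \<le> L - l"
      using bl l0 by linarith+
    have "1 ^ 5 \<le> L ^ 5" using L2 by (intro power_mono) auto
    then have "real n * 1 \<le> real n * L ^ 5" by (intro mult_left_mono) auto
    then have "c * real n \<le> c * (real n * L ^ 5)" using c by (intro mult_left_mono) auto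
    moreover have "2 * real k \<le> c * real n" using cn c by (simp add: field_simps)
    ultimately have Pk: "2 * k \<le> P n" using Pc by linarith
    then have P0: "real (P n) > 0" using k by simp
    have q2: "(q n)\<^sup>2 = N n / real n / real (P n)"
      unfolding q_def using N1 L2 by (intro real_sqrt_pow2) auto
    have q0: "0 \<le> q n" unfolding q_def using N1 L2 by simp
    have qP: "(q n)\<^sup>2 * real (P n) = N n / real n" using P0 by (simp add: q2)
    have "(real n * q n * N n)\<^sup>2 = real n * N n ^ 3 / real (P n)"
      unfolding power_mult_distrib q2 using n2 by (simp add: power2_eq_square power3_eq_cube)
    also have "\<dots> \<le> real n * (2 * L) ^ 3 / (c * (real n * L ^ 5))"
      using Pc N1 N2 L2 c n2 by (intro frac_le mult_left_mono power_mono) auto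
    also have "\<dots> = 8 / (c * L\<^sup>2)"
      using n2 L2 c by (simp add: power_mult_distrib field_simps)
    also have "\<dots> \<le> (1 / 2)\<^sup>2" using Lc c L2 by (simp add: field_simps power2_eq_square)
    finally have nqN: "real n * q n * N n \<le> 1 / 2"
      by (rule power2_le_imp_le) simp
    have "real n * q n * 1 \<le> real n * q n * N n"
      using N1 L2 q0 by (intro mult_left_mono) auto
    then have nq: "real n * q n \<le> 1 / 2" using nqN by simp
    have "N n / real n \<le> 2 * L / real n" using N2 by (intro divide_right_mono) auto
    moreover have "2 * L / real n \<le> 1" using Ln n2 by (simp add: field_simps)
    ultimately show ?case
      using n2 L2 Pk qP N1 N2 N3 q0 nq nqN by (simp add: L_def l_def)
  qed
qed

theorem theorem4:
  fixes k :: nat and P :: "nat \<Rightarrow> nat" and p \<alpha> :: "nat \<Rightarrow> real"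
  assumes k_pos: "k \<ge> 1"
    and P_pos: "\<And>n. n \<ge> 1 \<Longrightarrow> P n \<ge> 1"
    and p_range: "\<And>n. n \<ge> 1 \<Longrightarrow> 0 \<le> p n \<and> p n \<le> 1"
    and alpha: "\<And>n. n \<ge> 2 \<Longrightarrow>
      (p n)\<^sup>2 * real (P n) =
        (ln (real n) + (real k - 1) * ln (ln (real n)) + \<alpha> n) / real n"
    and P_growth: "(\<lambda>n. real (P n)) \<in> \<Omega>(\<lambda>n. real n * ln (real n) ^ 5)"
  shows "(filterlim \<alpha> at_bot sequentially \<longrightarrow>
           (\<lambda>n. measure_pmf.prob (binomial_rig n (P n) (p n)) {G. k_robust k G})
             \<longlonglongrightarrow> 0) \<and>
         (filterlim \<alpha> at_top sequentially \<longrightarrow>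
           (\<lambda>n. measure_pmf.prob (binomial_rig n (P n) (p n)) {G. k_robust k G})
             \<longlonglongrightarrow> 1)"
proof -
  let ?R = "\<lambda>n p. measure_pmf.prob (binomial_rig n (P n) p) {G. k_robust k G}"
  define N where "N \<beta> n = ln (real n) + (real k - 1) * ln (ln (real n)) + \<beta> n" for \<beta> n
  define q where "q \<beta> n = sqrt (N \<beta> n / real n / real (P n))" for \<beta> n
  have p2: "(p n)\<^sup>2 = N \<alpha> n / real n / real (P n)" if "n \<ge> 2" for n
  proof -
    have "(p n)\<^sup>2 * real (P n) = N \<alpha> n / real n" using alpha[OF that] by (simp add: N_def)
    moreover have "real (P n) \<noteq> 0" using P_pos[of n] that by simp
    ultimately show ?thesis by (metis nonzero_mult_div_cancel_right)
  qed
  have lnln: "eventually (\<lambda>n::nat. 0 \<le> ln (ln (real n))) sequentially" by real_asymp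
  have zero: "(\<lambda>n. ?R n (p n)) \<longlonglongrightarrow> 0" if lim: "filterlim \<alpha> at_bot sequentially"
  proof -
    \<comment> \<open>Truncation from below: \<open>\<beta>\<close> still tends to minus infinity,
      now within the range of \<open>eventually_threshold_scale\<close>. As
      \<open>\<alpha> n \<le> \<beta> n\<close>, \<open>p n\<close> is at most
      \<open>q \<beta> n\<close>, and an upper bound at \<open>q \<beta> n\<close> carries over by
      monotonicity.\<close>
    define \<beta> where "\<beta> n = max (\<alpha> n) (- ln (ln (real n)))" for n
    define j where "j = k - 1"
    have "eventually (\<lambda>n. \<alpha> n \<le> 0) sequentially"
      using lim by (auto simp: filterlim_at_bot)
    then have "eventually (\<lambda>n. \<bar>\<beta> n\<bar> \<le> ln (ln (real n))) sequentially"
      using lnln by eventually_elim (auto simp: \<beta>_def)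
    note scale = eventually_threshold_scale[OF k_pos P_growth this, folded N_def, folded q_def]
    have "filterlim (\<lambda>n::nat. - ln (ln (real n))) at_bot sequentially" by real_asymp
    with lim have beta: "filterlim \<beta> at_bot sequentially"
      unfolding filterlim_at_bot \<beta>_def by (auto simp: eventually_conj_iff)
    \<comment> \<open>\<open>q0\<close> and \<open>s0\<close> make the correlation term of
      \<open>U\<close> vanish in the limit; its first term vanishes through
      \<open>exp (\<beta> n)\<close>.\<close>
    have q0: "(\<lambda>n. q \<beta> n) \<longlonglongrightarrow> 0"
    proof (rule tendsto_sandwich[of "\<lambda>_. 0" _ _ "\<lambda>n. 1 / real n"])
      show "eventually (\<lambda>n. q \<beta> n \<le> 1 / real n) sequentially"
        using scale by eventually_elim (auto simp: field_simps)
      show "eventually (\<lambda>n. 0 \<le> q \<beta> n) sequentially"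
        using scale by eventually_elim auto
    qed (auto intro: lim_1_over_n)
    have s0: "(\<lambda>n. (q \<beta> n)\<^sup>2 * real (P n)) \<longlonglongrightarrow> 0"
    proof (rule tendsto_sandwich[of "\<lambda>_. 0" _ _ "\<lambda>n. 2 * ln (real n) / real n"])
      show "eventually (\<lambda>n. (q \<beta> n)\<^sup>2 * real (P n) \<le> 2 * ln (real n) / real n) sequentially"
        using scale by eventually_elim auto
      show "(\<lambda>n. 2 * ln (real n) / real n) \<longlonglongrightarrow> 0" by real_asymp
    qed auto
    define U where "U n = 3 * exp 1 * (8 * real j) ^ j * exp (\<beta> n) +
      (exp (8 * ((q \<beta> n)\<^sup>2 * real (P n))) / (1 - q \<beta> n) ^ (2 * j) - 1)" for n
    have le: "eventually (\<lambda>n. ?R n (p n) \<le> U n) sequentially"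
      using scale
    proof eventually_elim
      case (elim n)
      let ?q = "q \<beta> n"
      let ?b = "real (n - n div 2) * (?q\<^sup>2 * (1 - ?q) ^ (n - 2))"
      let ?a = "1 - ?q + ?q * (1 - ?q) ^ (n - 1)"
      let ?a2 = "(1 - ?q)\<^sup>2 + 2 * ?q * (1 - ?q) ^ (n - 1)"
      let ?\<mu> = "real (n div 2) * real (P n choose j) * ?b ^ j * ?a ^ (P n - j)"
      have "?q * 1 \<le> ?q * real n" using elim by (intro mult_left_mono) auto
      then have q: "0 \<le> ?q" "?q \<le> 1 / 2" using elim by (auto simp: mult.commute)
      have "p n \<le> ?q" unfolding q_def
      proof (rule real_le_rsqrt)
        show "(p n)\<^sup>2 \<le> N \<beta> n / real n / real (P n)"
          using elim p2[of n] by (auto simp: N_def \<beta>_def intro!: divide_right_mono)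
      qed
      then have mono: "?R n (p n) \<le> ?R n ?q"
        using p_range[of n] elim q by (intro prob_k_robust_mono) auto
      have mu: "exp (- \<beta> n) / (3 * exp 1 * (8 * real j) ^ j) \<le> ?\<mu>"
        unfolding j_def using elim q k_pos
        by (intro expected_sparse_stars_ge) (auto simp: N_def)
      have pos: "0 < exp (- \<beta> n) / (3 * exp 1 * (8 * real j) ^ j)" by (cases "j = 0") auto
      have mupos: "0 < ?\<mu>" using pos mu by (rule less_le_trans)
      note mono
      also have "?R n ?q \<le> 1 / ?\<mu> + (?a2 ^ (P n - 2 * j) / ?a ^ (2 * (P n - j)) - 1)"
        unfolding j_def by (rule prob_k_robust_le[OF _ _ _ _ mupos[unfolded j_def]])
          (use elim q k_pos in auto)
      also have "?a2 ^ (P n - 2 * j) / ?a ^ (2 * (P n - j)) \<le>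
          exp (8 * (?q\<^sup>2 * real (P n))) / (1 - ?q) ^ (2 * j)"
        using elim q by (intro sparse_star_correlation_le) (auto simp: j_def)
      also have "1 / ?\<mu> \<le> 1 / (exp (- \<beta> n) / (3 * exp 1 * (8 * real j) ^ j))"
        by (rule divide_left_mono[OF mu _ mult_pos_pos[OF mupos pos]]) simp
      also have "\<dots> = 3 * exp 1 * (8 * real j) ^ j * exp (\<beta> n)"
        by (simp add: exp_minus field_simps)
      finally show ?case by (simp add: U_def)
    qed
    have U0: "U \<longlonglongrightarrow> 0"
    proof -
      have "(\<lambda>n. exp (\<beta> n)) \<longlonglongrightarrow> 0"
        using filterlim_compose[OF exp_at_bot beta] by simp
      then have "U \<longlonglongrightarrow> 3 * exp 1 * (8 * real j) ^ j * 0 + (exp (8 * 0) / (1 - 0) ^ (2 * j) - 1)"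
        unfolding U_def using q0 s0 by (intro tendsto_intros) auto
      then show ?thesis by simp
    qed
    show ?thesis
      by (rule tendsto_sandwich[OF _ le tendsto_const U0]) simp
  qed
  have one: "(\<lambda>n. ?R n (p n)) \<longlonglongrightarrow> 1" if lim: "filterlim \<alpha> at_top sequentially"
  proof -
    \<comment> \<open>Truncation from above: now \<open>\<beta> n \<le> \<alpha> n\<close>, so
      \<open>q \<beta> n \<le> p n\<close>, and a lower bound at \<open>q \<beta> n\<close> carries
      over.\<close>
    define \<beta> where "\<beta> n = min (\<alpha> n) (ln (ln (real n)))" for n
    define x where "x n = real k * (2 * exp 2) ^ (k - 1) * exp 4 * exp (- \<beta> n)" for n
    have "eventually (\<lambda>n. \<alpha> n \<ge> 0) sequentially"
      using lim by (auto simp: filterlim_at_top)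
    then have "eventually (\<lambda>n. \<bar>\<beta> n\<bar> \<le> ln (ln (real n))) sequentially"
      using lnln by eventually_elim (auto simp: \<beta>_def)
    note scale = eventually_threshold_scale[OF k_pos P_growth this, folded N_def, folded q_def]
    have "filterlim (\<lambda>n::nat. ln (ln (real n))) at_top sequentially" by real_asymp
    with lim have beta: "filterlim \<beta> at_top sequentially"
      unfolding filterlim_at_top \<beta>_def by (auto simp: eventually_conj_iff)
    have "(\<lambda>n. exp (- \<beta> n)) \<longlonglongrightarrow> 0"
      by (rule filterlim_compose[OF exp_at_bot iffD1[OF filterlim_uminus_at_top beta]])
    then have x0: "x \<longlonglongrightarrow> 0"
      unfolding x_def by (rule tendsto_mult_right_zero)
    then have "eventually (\<lambda>n. x n < 1 / 2) sequentially"
      by (rule order_tendstoD) simp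
    with scale have ge: "eventually (\<lambda>n. 1 - 2 * x n \<le> ?R n (p n)) sequentially"
    proof eventually_elim
      case (elim n)
      let ?q = "q \<beta> n"
      have "?q * 1 \<le> ?q * real n" using elim by (intro mult_left_mono) auto
      then have q: "0 \<le> ?q" "?q \<le> 1" using elim by (auto simp: mult.commute)
      have ge: "1 - 2 * x n \<le> ?R n ?q"
        unfolding x_def using elim q k_pos
        by (intro prob_k_robust_ge) (auto simp: N_def x_def)
      have "?q \<le> p n" unfolding q_def
      proof (rule real_le_lsqrt)
        show "N \<beta> n / real n / real (P n) \<le> (p n)\<^sup>2"
          using elim p2[of n] by (auto simp: N_def \<beta>_def intro!: divide_right_mono)
      qed (use p_range[of n] elim in auto)
      then have "?R n ?q \<le> ?R n (p n)"
        using p_range[of n] elim q by (intro prob_k_robust_mono) auto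
      with ge show ?case by (rule order_trans)
    qed
    have "(\<lambda>n. 1 - 2 * x n) \<longlonglongrightarrow> 1 - 2 * 0"
      using x0 by (intro tendsto_intros)
    then have x1: "(\<lambda>n. 1 - 2 * x n) \<longlonglongrightarrow> 1" by simp
    show ?thesis
      by (rule tendsto_sandwich[OF ge _ x1 tendsto_const]) simp
  qed
  show ?thesis using zero one by blast
qed

end
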